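(* Let $K\in BC^1(\mathbf{R}^2)$ be real-valued and satisfy: (i) there is $k_m>0$ with $K(x)\ge k_m$ for all $x\in\mathbf{R}^2$; (ii) there are constants $r_0>0$ and $k_0\ge k_m$ with $K(x)=k_0$ for all $|x|>r_0$; (iii) $\nabla K\in (L^\infty(\mathbf{R}^2))^2$. Assume that $$\eta_0:=\frac{r_0}{k_m}\|\nabla K\|_\infty\in[0,1).$$ Let $L>0$ and let $u_0,u_1\in C_0^\infty(\mathbf{R}^2)$ be real-valued with $\operatorname{supp}u_j\subset B_L:=\{x\in\mathbf{R}^2:|x|\le L\}$ ($j=0,1$). Let $u(t,x)$ be the unique smooth solution of $$u_{tt}-\nabla\cdot(K(x)\nabla u)=0\ \ \text{in }(0,\infty)\times\mathbf{R}^2,\qquad u(0,x)=u_0(x),\ u_t(0,x)=u_1(x).$$ Let $R>r_0$ be arbitrary and fixed. Then $$E_{u,R}(t):=\frac12\int_{|x|\le R}\big(|u_t(t,x)|^2+K(x)|\nabla u(t,x)|^2\big)\,dx=O\big(t^{\eta_0-1}\sqrt{\log t}\big)\quad(t\to\infty).$$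
   Context: $BC^1(\mathbf{R}^2)$ denotes the bounded continuous functions on $\mathbf{R}^2$ whose first partial derivatives exist and are bounded continuous. $\|\nabla K\|_\infty$ is the $L^\infty(\mathbf{R}^2)$-norm of $|\nabla K|$. All functions are real-valued. $f(t)=O(g(t))$ $(t\to\infty)$ means $|f(t)|\le Cg(t)$ for all sufficiently large $t$, for some constant $C$. *)

theory Defs
  imports "HOL-Analysis.Analysis" "HOL-Library.Landau_Symbols"
begin

definition pd :: "2 \<Rightarrow> (real^2 \<Rightarrow> real) \<Rightarrow> real^2 \<Rightarrow> real" where
  "pd i f = (\<lambda>x. frechet_derivative f (at x) (axis i 1))"

definition grad :: "(real^2 \<Rightarrow> real) \<Rightarrow> real^2 \<Rightarrow> real^2" where
  "grad f x = (\<chi> i. pd i f x)"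

definition BC1 :: "(real^2 \<Rightarrow> real) \<Rightarrow> bool" where
  "BC1 f \<longleftrightarrow> continuous_on UNIV f \<and> bounded (range f) \<and>
     (\<forall>x. f differentiable (at x)) \<and>
     (\<forall>i. continuous_on UNIV (pd i f) \<and> bounded (range (pd i f)))"

text \<open>L^infinity norm of the (continuous) gradient, i.e. sup of its Euclidean length.\<close>
definition grad_sup_norm :: "(real^2 \<Rightarrow> real) \<Rightarrow> real" where
  "grad_sup_norm f = (SUP x. norm (grad f x))"

definition smooth :: "(real^2 \<Rightarrow> real) \<Rightarrow> bool" where
  "smooth f \<longleftrightarrow> (\<forall>is x. (fold pd is f) differentiable (at x))"

definition support :: "(real^2 \<Rightarrow> real) \<Rightarrow> (real^2) set" where
  "support f = closure {x. f x \<noteq> 0}"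

end

theory Submission
  imports Defs "HOL-Real_Asymp.Real_Asymp"
begin

text \<open>
  In two dimensions the multiplier \<open>x \<cdot> \<nabla>u + u/2\<close> gives
  \<open>d/dt \<integral> u\<^sub>t (x \<cdot> \<nabla>u + u/2) = - E + 1/2 \<integral> (x \<cdot> \<nabla>K) |\<nabla>u|\<^sup>2\<close>, and the last integral is at most
  \<open>\<eta>\<^sub>0\<close> times the energy in the ball of radius \<open>r\<^sub>0\<close>. By finite propagation speed \<open>u\<close> vanishes for
  \<open>|x| > \<rho> + t sqrt k\<^sub>0\<close>, where \<open>\<rho> = max L r\<^sub>0\<close>, so that
  \<open>(t + \<rho> / sqrt k\<^sub>0) E + \<integral> u\<^sub>t (x \<cdot> \<nabla>u + u/2)\<close> dominates \<open>t\<close> times the local energy up to a term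
  of size \<open>\<parallel>u\<parallel>\<^sub>2\<close>. A Gronwall argument then gives the decay rate \<open>t\<close> to the power \<open>\<eta>\<^sub>0 - 1\<close> times
  \<open>\<parallel>u\<parallel>\<^sub>2\<close>, and \<open>\<parallel>u\<parallel>\<^sub>2\<close> grows at most like \<open>sqrt (ln t)\<close>: this follows from the energy identity
  for a time primitive of \<open>u\<close> and a Hardy inequality with logarithmic constant for functions
  supported in a disc.
\<close>

section \<open>Integration by parts on the plane\<close>

text \<open>Bounding the growth of the L2 norm of u directly by the conserved energy allows linear
  growth in t, which would leave no decay at all. Passing to a time primitive v makes u the velocity
  of v, so that the square of this norm becomes part of an energy. The price is a source term
  independent of time, which has to be paired with v. In the plane the weighted norm of v is not
  controlled by its gradient with a uniform constant, and the loss is the logarithm of the support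
  radius, which itself grows linearly in t. The exponent comes from \<open>|x . grad K| \<le> r0 *
  sup |grad K| = \<eta> * km \<le> \<eta> * K\<close> on the disc of radius \<open>r0\<close>,
  outside of which the gradient of K vanishes. Two speeds occur: outside the disc of radius R the
  flux is compared with the energy at speed \<open>sqrt k0\<close>, matching the growth of the
  support exactly; inside, only the lower bound \<open>km\<close> is at hand, and since the disc is
  fixed this costs a bounded shift of t.\<close>

definition centred_cube :: "real \<Rightarrow> (real^2) set" where
  "centred_cube r = cbox (\<chi> i. - r) (\<chi> i. r)"

lemma cball_subset_centred_cube: "cball 0 r \<subseteq> centred_cube r"
proof
  fix x :: "real^2" assume "x \<in> cball 0 r"
  then have "\<bar>x $ i\<bar> \<le> r" for i
    using component_le_norm_cart[of x i] by auto
  then show "x \<in> centred_cube r"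
    by (auto simp: centred_cube_def mem_box_cart abs_le_iff) (smt (verit) abs_le_iff)
qed

lemma integral_UNIV_eq_support_set:
  fixes f :: "'a::euclidean_space \<Rightarrow> real"
  assumes "\<And>x. x \<notin> S \<Longrightarrow> f x = 0"
  shows "integral UNIV f = integral S f"
proof -
  have "(\<lambda>x. if x \<in> S then f x else 0) = f" using assms by auto
  then show ?thesis using integral_restrict_UNIV[of S f] by simp
qed

lemma integral_UNIV_eq_cube:
  fixes f :: "real^2 \<Rightarrow> real"
  assumes "\<And>x. norm x > r \<Longrightarrow> f x = 0"
  shows "integral UNIV f = integral (centred_cube r) f"
proof (rule integral_UNIV_eq_support_set)
  fix x assume "x \<notin> centred_cube r"
  then show "f x = 0" using assms cball_subset_centred_cube[of r] by force
qed

lemma integrable_UNIV_compact_support: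
  fixes f :: "real^2 \<Rightarrow> real"
  assumes "continuous_on UNIV f" "\<And>x. norm x > r \<Longrightarrow> f x = 0"
  shows "f integrable_on UNIV"
proof -
  have "(\<lambda>x. if x \<in> centred_cube r then f x else 0) = f"
    using assms(2) cball_subset_centred_cube[of r] by force
  moreover have "f integrable_on centred_cube r"
    unfolding centred_cube_def
    by (rule integrable_continuous) (rule continuous_on_subset[OF assms(1)], simp)
  ultimately show ?thesis using integrable_restrict_UNIV[of "centred_cube r" f] by simp
qed

text \<open>Passes between local and global integrals: it bounds the local energy by a global
  functional and, with both signs reversed, the global drift term by the local energy.\<close>

lemma integral_le_UNIV_of_cball:
  fixes f g :: "real^2 \<Rightarrow> real"
  assumes f: "continuous_on UNIV f" and g: "continuous_on UNIV g"
    and g0: "\<And>x. norm x > r \<Longrightarrow> g x = 0"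
    and le: "\<And>x. norm x \<le> R \<Longrightarrow> f x \<le> g x" and nonneg: "\<And>x. norm x > R \<Longrightarrow> 0 \<le> g x"
  shows "integral (cball 0 R) f \<le> integral UNIV g"
proof -
  have int: "f integrable_on cball 0 R"
  proof -
    have "integrable lborel (\<lambda>x. indicator (cball 0 R) x *\<^sub>R f x)"
      by (rule borel_integrable_compact) (auto intro: continuous_on_subset[OF f])
    then have "set_integrable lebesgue (cball 0 R) f"
      unfolding set_integrable_def using integrable_completion[of _ lborel]
      by (metis (no_types, lifting) borel_measurable_integrable integrable_completion)
    then show ?thesis using set_lebesgue_integral_eq_integral(1) by blast
  qed
  have "integral (cball 0 R) f = integral UNIV (\<lambda>x. if x \<in> cball 0 R then f x else 0)"
    by (rule integral_restrict_UNIV[symmetric])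
  also have "\<dots> \<le> integral UNIV g"
  proof (rule integral_le)
    show "(\<lambda>x. if x \<in> cball 0 R then f x else 0) integrable_on UNIV"
      using int integrable_restrict_UNIV by blast
    show "g integrable_on UNIV" by (rule integrable_UNIV_compact_support[OF g g0])
  qed (use le nonneg in \<open>auto simp: not_le\<close>)
  finally show ?thesis .
qed

lemma integral_UNIV_translation:
  fixes f :: "real^2 \<Rightarrow> real"
  assumes f: "continuous_on UNIV f" and f0: "\<And>x. norm x > r \<Longrightarrow> f x = 0"
  shows "integral UNIV (\<lambda>x. f (x + c)) = integral UNIV f"
proof -
  have "(f has_integral integral (centred_cube r) f) (centred_cube r)"
    unfolding centred_cube_def
    by (intro integrable_integral integrable_continuous continuous_on_subset[OF f]) simp
  from has_integral_affinity'[OF this[unfolded centred_cube_def], of 1 c]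
  have *: "((\<lambda>x. f (x + c)) has_integral integral (centred_cube r) f)
      (cbox ((\<chi> i. - r) - c) ((\<chi> i. r) - c))"
    by (simp add: centred_cube_def)
  have "integral UNIV (\<lambda>x. f (x + c)) = integral (cbox ((\<chi> i. - r) - c) ((\<chi> i. r) - c)) (\<lambda>x. f (x + c))"
  proof (rule integral_UNIV_eq_support_set)
    fix x assume "x \<notin> cbox ((\<chi> i. - r) - c) ((\<chi> i. r) - c)"
    then have "x + c \<notin> centred_cube r" by (auto simp: centred_cube_def mem_box_cart algebra_simps)
    then show "f (x + c) = 0" using f0 cball_subset_centred_cube[of r] by force
  qed
  also have "\<dots> = integral (centred_cube r) f" using * by (rule integral_unique)
  also have "\<dots> = integral UNIV f" by (rule integral_UNIV_eq_cube[symmetric]) (rule f0)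
  finally show ?thesis .
qed

lemma derivative_zero_if_locally_zero:
  fixes f :: "real^2 \<Rightarrow> real"
  assumes "((\<lambda>h. f (x + h *\<^sub>R v)) has_real_derivative d) (at 0)"
    and "open S" "x \<in> S" "\<And>y. y \<in> S \<Longrightarrow> f y = 0"
  shows "d = 0"
proof -
  have "((\<lambda>h::real. x + h *\<^sub>R v) \<longlongrightarrow> x + 0 *\<^sub>R v) (nhds 0)"
    by (intro tendsto_intros) (rule filterlim_ident)
  then have "\<forall>\<^sub>F h in nhds (0::real). x + h *\<^sub>R v \<in> S"
    using assms(2,3) by (intro topological_tendstoD) auto
  then have ev: "\<forall>\<^sub>F h in nhds (0::real). f (x + h *\<^sub>R v) = 0"
    by (rule eventually_mono) (rule assms(4))
  have "((\<lambda>h. 0::real) has_real_derivative d) (at 0)"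
    using DERIV_cong_ev[OF refl ev refl] assms(1) by blast
  then show ?thesis using DERIV_unique DERIV_const by blast
qed

lemma directional_derivative_shift:
  fixes f f' :: "'a::real_vector \<Rightarrow> real"
  assumes "\<And>x. ((\<lambda>h. f (x + h *\<^sub>R v)) has_real_derivative f' x) (at 0)"
  shows "((\<lambda>h. f (x + h *\<^sub>R v)) has_real_derivative f' (x + h *\<^sub>R v)) (at h)"
  using assms[of "x + h *\<^sub>R v"] DERIV_shift[of "\<lambda>h. f (x + h *\<^sub>R v)" "f' (x + h *\<^sub>R v)" 0 h]
  by (simp add: algebra_simps)

text \<open>Translation invariance makes \<open>\<integral> f (x + h v) dx\<close> constant in \<open>h\<close>; differentiate at \<open>h = 0\<close>.\<close>
lemma integral_derivative_zero:
  fixes f f' :: "real^2 \<Rightarrow> real"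
  assumes f: "\<And>x. ((\<lambda>h. f (x + h *\<^sub>R v)) has_real_derivative f' x) (at 0)"
    and cf: "continuous_on UNIV f" and cf': "continuous_on UNIV f'"
    and f0: "\<And>x. norm x > r \<Longrightarrow> f x = 0"
  shows "integral UNIV f' = 0"
proof -
  \<comment> \<open>Large enough for one fixed cube to contain the supports of all translates by
    \<open>h *\<^sub>R v\<close> with |h| < 1.\<close>
  define \<rho> where "\<rho> = r + norm v"
  let ?B = "centred_cube \<rho>"
  have f'0: "f' x = 0" if "norm x > r" for x
    by (rule derivative_zero_if_locally_zero[OF f, of "- cball 0 r"]) (use that f0 in auto)
  have D: "((\<lambda>h. f (x + h *\<^sub>R v)) has_real_derivative f' (x + h *\<^sub>R v)) (at h)" for x h
    by (rule directional_derivative_shift[OF f])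
  have "((\<lambda>h. integral ?B (\<lambda>x. f (x + h *\<^sub>R v))) has_real_derivative integral ?B (\<lambda>x. f' (x + 0 *\<^sub>R v)))
     (at 0 within {-1<..<1})"
    unfolding centred_cube_def
  proof (rule leibniz_rule_field_derivative)
    show "((\<lambda>h. f (x + h *\<^sub>R v)) has_real_derivative f' (x + h *\<^sub>R v)) (at h within {-1<..<1})" for x h
      using D has_field_derivative_at_within by blast
    show "(\<lambda>x. f (x + h *\<^sub>R v)) integrable_on cbox (\<chi> i. - \<rho>) (\<chi> i. \<rho>)" for h
      by (intro integrable_continuous continuous_on_compose2[OF cf] continuous_intros) auto
    show "continuous_on ({- 1<..<1} \<times> cbox (\<chi> i. - \<rho>) (\<chi> i. \<rho>)) (\<lambda>(h, x). f' (x + h *\<^sub>R v))"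
      unfolding split_beta by (intro continuous_on_compose2[OF cf'] continuous_intros) auto
  qed auto
  then have L: "((\<lambda>h. integral ?B (\<lambda>x. f (x + h *\<^sub>R v))) has_real_derivative integral ?B f') (at 0)"
    by (simp add: at_within_open[of 0 "{-1<..<1}"])
  have c: "integral ?B (\<lambda>x. f (x + h *\<^sub>R v)) = integral UNIV f" if "h \<in> {-1<..<1}" for h
  proof -
    have "integral ?B (\<lambda>x. f (x + h *\<^sub>R v)) = integral UNIV (\<lambda>x. f (x + h *\<^sub>R v))"
    proof (rule integral_UNIV_eq_cube[symmetric], rule f0)
      fix x :: "real^2" assume "\<rho> < norm x"
      moreover have "norm (h *\<^sub>R v) \<le> norm v" using that by (auto intro: mult_left_le_one_le)
      ultimately show "r < norm (x + h *\<^sub>R v)"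
        unfolding \<rho>_def using norm_diff_ineq[of x "h *\<^sub>R v"] by linarith
    qed
    also have "\<dots> = integral UNIV f" by (rule integral_UNIV_translation[OF cf f0])
    finally show ?thesis .
  qed
  have ev: "\<forall>\<^sub>F h in nhds 0. integral ?B (\<lambda>x. f (x + h *\<^sub>R v)) = integral UNIV f"
    by (rule eventually_mono[OF eventually_nhds_in_open[of "{-1<..<1}"] c]) auto
  have "((\<lambda>h. integral UNIV f) has_real_derivative integral ?B f') (at 0)"
    using DERIV_cong_ev[OF refl ev refl] L by blast
  then have "integral ?B f' = 0" using DERIV_unique DERIV_const by blast
  moreover have "integral UNIV f' = integral ?B f'"
    by (rule integral_UNIV_eq_cube, rule f'0) (use \<rho>_def in \<open>smt (verit) norm_ge_zero\<close>)
  ultimately show ?thesis by simp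
qed

lemma integral_divergence_zero:
  fixes F F' :: "2 \<Rightarrow> real^2 \<Rightarrow> real"
  assumes F: "\<And>i x. ((\<lambda>h. F i (x + h *\<^sub>R axis i 1)) has_real_derivative F' i x) (at 0)"
    and cF: "\<And>i. continuous_on UNIV (F i)" and cF': "\<And>i. continuous_on UNIV (F' i)"
    and F0: "\<And>i x. norm x > r \<Longrightarrow> F i x = 0"
  shows "integral UNIV (\<lambda>x. \<Sum>i\<in>UNIV. F' i x) = 0"
    and "norm x > r \<Longrightarrow> F' i x = 0"
proof -
  show F'0: "F' i x = 0" if "norm x > r" for x i
    by (rule derivative_zero_if_locally_zero[OF F, of "- cball 0 r"]) (use that F0 in auto)
  have "integral UNIV (\<lambda>x. \<Sum>i\<in>UNIV. F' i x) = (\<Sum>i\<in>UNIV. integral UNIV (F' i))"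
    by (intro integral_sum integrable_UNIV_compact_support[OF cF']) (auto intro: F'0)
  also have "\<dots> = 0"
    by (intro sum.neutral ballI integral_derivative_zero[OF F cF cF']) (rule F0)
  finally show "integral UNIV (\<lambda>x. \<Sum>i\<in>UNIV. F' i x) = 0" .
qed

lemma continuous_on_slice:
  fixes f :: "'a::topological_space \<Rightarrow> 'b::topological_space \<Rightarrow> 'c::topological_space"
  assumes "continuous_on (U \<times> UNIV) (\<lambda>z. f (fst z) (snd z))" "t \<in> U"
  shows "continuous_on UNIV (f t)"
proof -
  have "continuous_on UNIV (\<lambda>x. f (fst (t, x)) (snd (t, x)))"
    by (rule continuous_on_compose2[OF assms(1)]) (use assms(2) in \<open>auto intro!: continuous_intros\<close>)
  then show ?thesis by simp
qed

text \<open>A divergence integrates to zero, so subtracting one is free, and each energy identity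
  below reduces to a pointwise computation of \<open>q' - div F\<close>. The density is needed near
  t, the flux only at t; the radius must serve all nearby times at once, hence radii such as
  \<open>support_radius (t + 1)\<close> later.\<close>

lemma balance_law:
  fixes q q' :: "real \<Rightarrow> real^2 \<Rightarrow> real" and F F' :: "2 \<Rightarrow> real^2 \<Rightarrow> real"
  assumes t: "a < t" "t < b"
    and q: "\<And>s x. a < s \<Longrightarrow> s < b \<Longrightarrow> ((\<lambda>s. q s x) has_real_derivative q' s x) (at s)"
    and cq: "\<And>s. a < s \<Longrightarrow> s < b \<Longrightarrow> continuous_on UNIV (q s)"
    and cq': "continuous_on ({a<..<b} \<times> UNIV) (\<lambda>z. q' (fst z) (snd z))"
    and q0: "\<And>s x. a < s \<Longrightarrow> s < b \<Longrightarrow> norm x > r \<Longrightarrow> q s x = 0"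
    and F: "\<And>i x. ((\<lambda>h. F i (x + h *\<^sub>R axis i 1)) has_real_derivative F' i x) (at 0)"
    and cF: "\<And>i. continuous_on UNIV (F i)" and cF': "\<And>i. continuous_on UNIV (F' i)"
    and F0: "\<And>i x. norm x > r \<Longrightarrow> F i x = 0"
  shows "((\<lambda>s. integral UNIV (q s)) has_real_derivative
      integral UNIV (\<lambda>x. q' t x - (\<Sum>i\<in>UNIV. F' i x))) (at t)"
proof -
  have q'0: "q' t x = 0" if "norm x > r" for x
  proof -
    have ev: "\<forall>\<^sub>F s in nhds t. q s x = 0"
      by (rule eventually_mono[OF eventually_nhds_in_open[of "{a<..<b}"]]) (use t q0 that in auto)
    have "((\<lambda>s. 0::real) has_real_derivative q' t x) (at t)"
      using DERIV_cong_ev[OF refl ev refl] q[OF t] by blast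
    then show ?thesis using DERIV_unique DERIV_const by blast
  qed
  have cq't: "continuous_on UNIV (q' t)"
    by (rule continuous_on_slice[OF cq']) (use t in simp)
  have "((\<lambda>s. integral (centred_cube r) (q s)) has_real_derivative integral (centred_cube r) (q' t))
     (at t within {a<..<b})"
    unfolding centred_cube_def
  proof (rule leibniz_rule_field_derivative)
    show "((\<lambda>s. q s x) has_real_derivative q' s x) (at s within {a<..<b})" if "s \<in> {a<..<b}" for s x
      by (rule has_field_derivative_at_within, rule q) (use that in auto)
    show "q s integrable_on cbox (\<chi> i. - r) (\<chi> i. r)" if "s \<in> {a<..<b}" for s
      using that by (intro integrable_continuous continuous_on_subset[OF cq]) auto
    show "continuous_on ({a<..<b} \<times> cbox (\<chi> i. - r) (\<chi> i. r)) (\<lambda>(s, x). q' s x)"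
      unfolding split_beta by (rule continuous_on_subset[OF cq']) auto
  qed (use t in auto)
  then have L: "((\<lambda>s. integral (centred_cube r) (q s)) has_real_derivative integral (centred_cube r) (q' t)) (at t)"
    using t by (simp add: at_within_open[of t "{a<..<b}"])
  have ev: "\<forall>\<^sub>F s in nhds t. integral (centred_cube r) (q s) = integral UNIV (q s)"
    by (rule eventually_mono[OF eventually_nhds_in_open[of "{a<..<b}"]])
      (use t q0 in \<open>auto intro!: integral_UNIV_eq_cube[symmetric]\<close>)
  have "integral UNIV (\<lambda>x. q' t x - (\<Sum>i\<in>UNIV. F' i x)) = integral UNIV (q' t) - integral UNIV (\<lambda>x. \<Sum>i\<in>UNIV. F' i x)"
  proof (rule integral_diff)
    show "q' t integrable_on UNIV" by (rule integrable_UNIV_compact_support[OF cq't q'0])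
    show "(\<lambda>x. \<Sum>i\<in>UNIV. F' i x) integrable_on UNIV"
      by (rule integrable_UNIV_compact_support[where r=r], intro continuous_intros cF')
        (simp add: integral_divergence_zero(2)[OF F cF cF' F0])
  qed
  also have "\<dots> = integral UNIV (q' t)"
    using integral_divergence_zero(1)[OF F cF cF' F0] by simp
  also have "\<dots> = integral (centred_cube r) (q' t)"
    by (rule integral_UNIV_eq_cube[OF q'0])
  finally have "integral UNIV (\<lambda>x. q' t x - (\<Sum>i\<in>UNIV. F' i x)) = integral (centred_cube r) (q' t)" .
  then show ?thesis
    using DERIV_cong_ev[OF refl ev refl] L by metis
qed

lemma norm_power2_vec2: "(norm (x::real^2))\<^sup>2 = (x$1)\<^sup>2 + (x$2)\<^sup>2"
  unfolding power2_norm_eq_inner inner_vec_def by (simp add: sum_2 power2_eq_square)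

lemma has_real_derivative_coordinate:
  "((\<lambda>h. (x + h *\<^sub>R axis i 1 :: real^2) $ j) has_real_derivative (if i = j then 1 else 0)) (at 0)"
  by (auto intro!: derivative_eq_intros simp: axis_def)

lemma continuous_on_slice_fst:
  fixes f :: "'a::topological_space \<Rightarrow> 'b::topological_space \<Rightarrow> 'c::topological_space"
  assumes "continuous_on (U \<times> V) (\<lambda>z. f (fst z) (snd z))" "x \<in> V"
  shows "continuous_on U (\<lambda>s. f s x)"
proof -
  have "continuous_on U (\<lambda>s. f (fst (s, x)) (snd (s, x)))"
    by (rule continuous_on_compose2[OF assms(1)]) (use assms(2) in \<open>auto intro!: continuous_intros\<close>)
  then show ?thesis by simp
qed

section \<open>Primitives in time: continuity and derivatives\<close>

lemma integral_eq_scaled: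
  fixes g :: "real \<Rightarrow> real"
  assumes "continuous_on {a..} g" "a \<le> t"
  shows "integral {a..t} g = (t - a) * integral {0..1} (\<lambda>\<sigma>. g ((t - a) * \<sigma> + a))"
proof (cases "t = a")
  case False
  then have ta: "t - a > 0" using assms(2) by simp
  have "(g has_integral integral {a..t} g) (cbox a t)"
    using assms by (auto intro!: integrable_integral integrable_continuous_interval continuous_on_subset[OF assms(1)])
  from has_integral_affinity'[OF this ta, of a]
  have "((\<lambda>\<sigma>. g ((t - a) * \<sigma> + a)) has_integral integral {a..t} g / (t - a)) {0..1}"
    using ta by (simp add: field_simps)
  then show ?thesis using ta by (simp add: integral_unique)
qed simp

text \<open>Rescaling to the fixed interval [0, 1] moves the variable endpoint into the integrand,
  where continuity of parametric integrals applies.\<close>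

lemma continuous_on_antiderivative:
  fixes g :: "real \<Rightarrow> 'b::topological_space \<Rightarrow> real"
  assumes g: "continuous_on ({a..} \<times> UNIV) (\<lambda>z. g (fst z) (snd z))"
  shows "continuous_on ({a..} \<times> UNIV) (\<lambda>z. integral {a..fst z} (\<lambda>s. g s (snd z)))"
proof -
  have g1: "continuous_on {a..} (\<lambda>s. g s x)" for x
    by (rule continuous_on_slice_fst[OF g]) simp
  have "continuous_on ({a..} \<times> UNIV) (\<lambda>z::real \<times> 'b. integral (cbox 0 1) (\<lambda>\<sigma>. g ((fst z - a) * \<sigma> + a) (snd z)))"
  proof (rule integral_continuous_on_param)
    have "continuous_on (({a..} \<times> UNIV) \<times> cbox 0 1)
        (\<lambda>w :: (real \<times> 'b) \<times> real. g (fst ((fst (fst w) - a) * snd w + a, snd (fst w))) (snd ((fst (fst w) - a) * snd w + a, snd (fst w))))"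
      by (rule continuous_on_compose2[OF g]) (auto intro!: continuous_intros)
    then show "continuous_on (({a..} \<times> UNIV) \<times> cbox 0 1)
        (\<lambda>(z :: real \<times> 'b, \<sigma>). g ((fst z - a) * \<sigma> + a) (snd z))"
      by (simp add: split_beta)
  qed
  then have "continuous_on ({a..} \<times> UNIV) (\<lambda>z::real \<times> 'b. (fst z - a) * integral {0..1} (\<lambda>\<sigma>. g ((fst z - a) * \<sigma> + a) (snd z)))"
    by (auto intro!: continuous_intros)
  then show ?thesis
    by (rule continuous_on_eq) (auto simp: integral_eq_scaled[OF g1])
qed

lemma antiderivative_directional_derivative:
  fixes g g' :: "real \<Rightarrow> 'a::real_normed_vector \<Rightarrow> real"
  assumes g: "\<And>s x. a \<le> s \<Longrightarrow> ((\<lambda>h. g s (x + h *\<^sub>R v)) has_real_derivative g' s x) (at 0)"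
    and cg: "continuous_on ({a..} \<times> UNIV) (\<lambda>z. g (fst z) (snd z))"
    and cg': "continuous_on ({a..} \<times> UNIV) (\<lambda>z. g' (fst z) (snd z))"
  shows "((\<lambda>h. integral {a..t} (\<lambda>s. g s (x + h *\<^sub>R v))) has_real_derivative integral {a..t} (\<lambda>s. g' s x)) (at 0)"
proof -
  have "((\<lambda>h. integral (cbox a t) (\<lambda>s. g s (x + h *\<^sub>R v))) has_real_derivative
      integral (cbox a t) (\<lambda>s. g' s (x + 0 *\<^sub>R v))) (at 0 within UNIV)"
  proof (rule leibniz_rule_field_derivative)
    show "((\<lambda>h. g s (x + h *\<^sub>R v)) has_real_derivative g' s (x + h *\<^sub>R v)) (at h)" if "s \<in> cbox a t" for h s
      by (rule directional_derivative_shift) (use that g in auto)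
    show "(\<lambda>s. g s (x + h *\<^sub>R v)) integrable_on cbox a t" for h
      by (intro integrable_continuous continuous_on_subset[OF continuous_on_slice_fst[OF cg]]) auto
    have "continuous_on (UNIV \<times> cbox a t) (\<lambda>w. g' (fst (snd w, x + fst w *\<^sub>R v)) (snd (snd w, x + fst w *\<^sub>R v)))"
      by (rule continuous_on_compose2[OF cg']) (auto intro!: continuous_intros)
    then show "continuous_on (UNIV \<times> cbox a t) (\<lambda>(h, s). g' s (x + h *\<^sub>R v))"
      by (simp add: split_beta)
  qed auto
  then show ?thesis by simp
qed

lemma antiderivative_time_derivative:
  fixes g :: "real \<Rightarrow> real"
  assumes "continuous_on {a..} g" "a < t"
  shows "((\<lambda>t. integral {a..t} g) has_real_derivative g t) (at t)"
proof -
  have "((\<lambda>t. integral {a..t} g) has_real_derivative g t) (at t within {a..t+1})"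
    by (rule integral_has_real_derivative) (use assms in \<open>auto intro: continuous_on_subset\<close>)
  then have "((\<lambda>t. integral {a..t} g) has_real_derivative g t) (at t within {a<..<t+1})"
    by (rule DERIV_subset) auto
  then show ?thesis using assms(2) by (simp add: at_within_open[of t "{a<..<t+1}"])
qed

section \<open>Radial multipliers and the logarithmic Hardy inequality\<close>

text \<open>The vector field \<open>f\<^sup>2 G(1 + |x|\<^sup>2) x\<close> has zero total divergence.\<close>
lemma radial_multiplier_identity:
  fixes f :: "real^2 \<Rightarrow> real" and g :: "2 \<Rightarrow> real^2 \<Rightarrow> real" and G G' :: "real \<Rightarrow> real"
  assumes f: "\<And>i x. ((\<lambda>h. f (x + h *\<^sub>R axis i 1)) has_real_derivative g i x) (at 0)"
    and cf: "continuous_on UNIV f" and cg: "\<And>i. continuous_on UNIV (g i)"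
    and f0: "\<And>x. norm x > r \<Longrightarrow> f x = 0"
    and G: "\<And>s. s \<ge> 1 \<Longrightarrow> (G has_real_derivative G' s) (at s)" and cG': "continuous_on {1..} G'"
  defines "S \<equiv> \<lambda>x::real^2. 1 + ((x$1)\<^sup>2 + (x$2)\<^sup>2)"
  shows "((\<lambda>x. 2 * f x * (\<Sum>i\<in>UNIV. x$i * g i x) * G (S x) + 2 * (f x)\<^sup>2 * (G (S x) + (S x - 1) * G' (S x)))
    has_integral 0) UNIV"
proof -
  define F where "F i x = (f x)\<^sup>2 * x$i * G (S x)" for i :: 2 and x
  define F' where "F' i x = 2 * f x * g i x * x$i * G (S x) + (f x)\<^sup>2 * G (S x)
      + (f x)\<^sup>2 * x$i * (G' (S x) * (2 * x$i))" for i :: 2 and x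
  have S1: "S x \<ge> 1" for x unfolding S_def by simp
  have cS: "continuous_on UNIV S" unfolding S_def by (intro continuous_intros)
  have cG: "continuous_on {1..} G"
    by (meson DERIV_isCont G atLeast_iff continuous_at_imp_continuous_on)
  have cGS: "continuous_on UNIV (\<lambda>x. G (S x))" "continuous_on UNIV (\<lambda>x. G' (S x))"
    by (auto intro!: continuous_on_compose2[OF cG cS] continuous_on_compose2[OF cG' cS] simp: S1)
  note [derivative_intros] = f has_real_derivative_coordinate
  have dS: "((\<lambda>h. S (x + h *\<^sub>R axis i 1)) has_real_derivative 2 * x$i) (at 0)" for i x
    unfolding S_def by (rule derivative_eq_intros refl)+ (use exhaust_2[of i] in auto)
  have dG: "((\<lambda>h. G (S (x + h *\<^sub>R axis i 1))) has_real_derivative G' (S x) * (2 * x$i)) (at 0)" for i x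
    using DERIV_chain2[of G "G' (S x)" "\<lambda>h. S (x + h *\<^sub>R axis i 1)" 0 "2 * x$i" UNIV] G[OF S1] dS[of x i] by simp
  note [derivative_intros] = dG
  have dF: "((\<lambda>h. F i (x + h *\<^sub>R axis i 1)) has_real_derivative F' i x) (at 0)" for i x
    unfolding F_def F'_def by (rule derivative_eq_intros refl)+ (simp add: algebra_simps power2_eq_square)
  have cF: "continuous_on UNIV (F i)" and cF': "continuous_on UNIV (F' i)" for i
    unfolding F_def F'_def by (intro continuous_intros cf cg cGS)+
  have F0: "F i x = 0" if "norm x > r" for i x unfolding F_def using f0[OF that] by simp
  have eq: "(\<lambda>x. \<Sum>i\<in>UNIV. F' i x) =
    (\<lambda>x. 2 * f x * (\<Sum>i\<in>UNIV. x$i * g i x) * G (S x) + 2 * (f x)\<^sup>2 * (G (S x) + (S x - 1) * G' (S x)))"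
    unfolding F'_def S_def by (rule ext) (simp add: sum_2 algebra_simps power2_eq_square)
  have "(\<lambda>x. \<Sum>i\<in>UNIV. F' i x) integrable_on UNIV"
    by (rule integrable_UNIV_compact_support[where r=r], intro continuous_intros cF')
      (simp add: integral_divergence_zero(2)[OF dF cF cF' F0])
  then show ?thesis
    using integral_divergence_zero(1)[OF dF cF cF' F0] unfolding eq has_integral_iff by simp
qed

text \<open>Applying the multiplier identity with \<open>G s = (1 + ln s) / s\<close> loses a squared logarithm;
  feeding that bound into the identity for \<open>G s = 1 / s\<close> recovers one of the two factors.\<close>
lemma log_hardy_inequality:
  fixes f :: "real^2 \<Rightarrow> real" and g :: "2 \<Rightarrow> real^2 \<Rightarrow> real"
  assumes f: "\<And>i x. ((\<lambda>h. f (x + h *\<^sub>R axis i 1)) has_real_derivative g i x) (at 0)"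
    and cf: "continuous_on UNIV f" and cg: "\<And>i. continuous_on UNIV (g i)"
    and f0: "\<And>x. norm x > r \<Longrightarrow> f x = 0"
  shows "integral UNIV (\<lambda>x. (f x)\<^sup>2 / (1 + (norm x)\<^sup>2)\<^sup>2)
     \<le> (1 + ln (1 + r\<^sup>2)) * integral UNIV (\<lambda>x. \<Sum>i\<in>UNIV. (g i x)\<^sup>2)"
proof -
  define S where "S x = 1 + ((x$1)\<^sup>2 + (x$2)\<^sup>2)" for x :: "real^2"
  define M where "M = 1 + ln (1 + r\<^sup>2)"
  define y where "y x = (\<Sum>i\<in>UNIV. x$i * g i x)" for x
  define n where "n x = (\<Sum>i\<in>UNIV. (g i x)\<^sup>2)" for x
  have Sn: "1 + (norm x)\<^sup>2 = S x" for x :: "real^2" unfolding S_def norm_power2_vec2 ..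
  have S1: "S x \<ge> 1" for x unfolding S_def by simp
  have Spos: "S x > 0" for x using S1[of x] by simp
  have M1: "M \<ge> 1" unfolding M_def by simp
  have n0: "n x \<ge> 0" for x unfolding n_def by (simp add: sum_nonneg)
  have yn: "(y x)\<^sup>2 \<le> S x * n x" for x
  proof -
    have "S x * n x - (y x)\<^sup>2 = n x + (x$1 * g 2 x - x$2 * g 1 x)\<^sup>2"
      unfolding S_def n_def y_def by (simp add: sum_2 algebra_simps power2_eq_square)
    then show ?thesis using n0[of x] by (smt (verit) zero_le_power2)
  qed
  have g0: "g i x = 0" if "norm x > r" for x i
    by (rule derivative_zero_if_locally_zero[OF f, of "- cball 0 r"]) (use that f0 in auto)
  have cS: "continuous_on UNIV S" unfolding S_def by (intro continuous_intros)
  have cn: "continuous_on UNIV n" unfolding n_def by (intro continuous_intros cg)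
  have int_n: "n integrable_on UNIV"
    by (rule integrable_UNIV_compact_support[OF cn, of r]) (simp add: n_def g0)
  have int1: "(\<lambda>x. (f x)\<^sup>2 / S x) integrable_on UNIV"
    by (rule integrable_UNIV_compact_support[of _ r], intro continuous_intros cf cS)
      (use Spos f0 in \<open>auto simp: less_imp_neq[THEN not_sym]\<close>)
  have int2: "(\<lambda>x. (f x)\<^sup>2 / (S x)\<^sup>2) integrable_on UNIV"
    by (rule integrable_UNIV_compact_support[of _ r], intro continuous_intros cf cS)
      (use Spos f0 in \<open>auto simp: less_imp_neq[THEN not_sym]\<close>)
  \<comment> \<open>\<open>G s = (1 + ln s) / s\<close> is chosen so that
    \<open>G + (s - 1) * G'\<close> equals \<open>1 / s + ln s / s\<^sup>2\<close>: the logarithms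
    of order \<open>ln s / s\<close> cancel and a coefficient of at least \<open>1 / s\<close> is
    left.\<close>
  have H1: "((\<lambda>x. 2 * f x * y x * ((1 + ln (S x)) / S x) +
      2 * (f x)\<^sup>2 * ((1 + ln (S x)) / S x + (S x - 1) * (- ln (S x) / (S x)\<^sup>2))) has_integral 0) UNIV"
    unfolding S_def y_def
    by (rule radial_multiplier_identity[OF f cf cg f0])
      (auto intro!: derivative_eq_intros continuous_intros simp: field_simps power2_eq_square)
  \<comment> \<open>Here \<open>G + (s - 1) * G'\<close> is exactly \<open>1 / s\<^sup>2\<close>,
    the weight in the claim.\<close>
  have H2: "((\<lambda>x. 2 * f x * y x * (1 / S x) +
      2 * (f x)\<^sup>2 * (1 / S x + (S x - 1) * (- 1 / (S x)\<^sup>2))) has_integral 0) UNIV"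
    unfolding S_def y_def
    by (rule radial_multiplier_identity[OF f cf cg f0])
      (auto intro!: derivative_eq_intros continuous_intros simp: field_simps power2_eq_square)
  have le1: "(f x)\<^sup>2 / S x - M\<^sup>2 * n x \<le> 2 * f x * y x * ((1 + ln (S x)) / S x) +
      2 * (f x)\<^sup>2 * ((1 + ln (S x)) / S x + (S x - 1) * (- ln (S x) / (S x)\<^sup>2))" (is "_ \<le> ?R") for x
  proof (cases "norm x > r")
    case True then show ?thesis using f0[OF True] n0[of x] by simp
  next
    case False
    define l where "l = 1 + ln (S x)"
    have l1: "l \<ge> 1" unfolding l_def using S1[of x] by simp
    have "S x \<le> 1 + r\<^sup>2" unfolding Sn[symmetric] using False by (simp add: power_mono)
    then have lM: "l \<le> M" unfolding l_def M_def using Spos[of x] by simp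
    have "?R = 2 * f x * y x * l / S x + 2 * (f x)\<^sup>2 / S x + 2 * (f x)\<^sup>2 * ((l - 1) / (S x)\<^sup>2)"
      unfolding l_def using Spos[of x] by (simp add: field_simps power2_eq_square)
    moreover have "2 * (f x)\<^sup>2 * ((l - 1) / (S x)\<^sup>2) \<ge> 0" using l1 by simp
    moreover have "0 \<le> (f x + l * y x)\<^sup>2 / S x" using Spos[of x] by simp
    moreover have "(f x + l * y x)\<^sup>2 / S x = (f x)\<^sup>2 / S x + 2 * f x * y x * l / S x + l\<^sup>2 * (y x)\<^sup>2 / S x"
      by (simp add: power2_eq_square algebra_simps add_divide_distrib)
    moreover have "l\<^sup>2 * (y x)\<^sup>2 / S x \<le> M\<^sup>2 * n x"
    proof -
      have "l\<^sup>2 * (y x)\<^sup>2 \<le> M\<^sup>2 * (S x * n x)"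
        using lM l1 yn[of x] by (intro mult_mono power_mono) auto
      then show ?thesis using Spos[of x] by (simp add: field_simps)
    qed
    ultimately show ?thesis by linarith
  qed
  have "integral UNIV (\<lambda>x. (f x)\<^sup>2 / S x - M\<^sup>2 * n x) \<le> 0"
    by (rule has_integral_le[OF integrable_integral H1 le1])
      (intro integrable_diff int1 integrable_on_mult_right int_n)
  moreover have "integral UNIV (\<lambda>x. (f x)\<^sup>2 / S x - M\<^sup>2 * n x) = integral UNIV (\<lambda>x. (f x)\<^sup>2 / S x) - M\<^sup>2 * integral UNIV n"
    by (subst integral_diff) (auto intro!: int1 integrable_on_mult_right int_n)
  ultimately have I1: "integral UNIV (\<lambda>x. (f x)\<^sup>2 / S x) \<le> M\<^sup>2 * integral UNIV n" by simp
  \<comment> \<open>The square completed here is \<open>(f + M * y)\<^sup>2 / (S * M)\<close>. The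
    factor \<open>1 / M\<close> on \<open>f\<^sup>2 / S\<close> turns the bound
    \<open>M\<^sup>2\<close> of \<open>I1\<close> into M, equal to the factor of the gradient term,
    so both contributions are linear in M.\<close>
  have le2: "2 * ((f x)\<^sup>2 / (S x)\<^sup>2) - ((1/M) * ((f x)\<^sup>2 / S x) + M * n x) \<le> 2 * f x * y x * (1 / S x) +
      2 * (f x)\<^sup>2 * (1 / S x + (S x - 1) * (- 1 / (S x)\<^sup>2))" (is "_ \<le> ?R") for x
  proof -
    have "?R = 2 * f x * y x / S x + 2 * ((f x)\<^sup>2 / (S x)\<^sup>2)"
      using Spos[of x] by (simp add: field_simps power2_eq_square)
    moreover have "0 \<le> (f x + M * y x)\<^sup>2 / (S x * M)" using Spos[of x] M1 by simp
    moreover have "(f x + M * y x)\<^sup>2 / (S x * M) = (1/M) * ((f x)\<^sup>2 / S x) + 2 * f x * y x / S x + M * ((y x)\<^sup>2 / S x)"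
      using M1 Spos[of x] by (simp add: power2_eq_square field_simps)
    moreover have "M * ((y x)\<^sup>2 / S x) \<le> M * n x"
      using yn[of x] Spos[of x] M1 by (intro mult_left_mono) (auto simp: field_simps)
    ultimately show ?thesis by linarith
  qed
  have "integral UNIV (\<lambda>x. 2 * ((f x)\<^sup>2 / (S x)\<^sup>2) - ((1/M) * ((f x)\<^sup>2 / S x) + M * n x)) \<le> 0"
    by (rule has_integral_le[OF integrable_integral H2 le2])
      (intro integrable_diff integrable_add int1 int2 integrable_on_mult_right int_n)
  moreover have "integral UNIV (\<lambda>x. 2 * ((f x)\<^sup>2 / (S x)\<^sup>2) - ((1/M) * ((f x)\<^sup>2 / S x) + M * n x))
     = 2 * integral UNIV (\<lambda>x. (f x)\<^sup>2 / (S x)\<^sup>2) - ((1/M) * integral UNIV (\<lambda>x. (f x)\<^sup>2 / S x) + M * integral UNIV n)"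
    by (subst integral_diff integral_add | (intro integrable_add int1 int2 integrable_on_mult_right int_n)[1])+
      (simp only: integral_mult_right)
  moreover have "(1/M) * integral UNIV (\<lambda>x. (f x)\<^sup>2 / S x) \<le> M * integral UNIV n"
    using I1 M1 by (simp add: field_simps power2_eq_square)
  ultimately have "integral UNIV (\<lambda>x. (f x)\<^sup>2 / (S x)\<^sup>2) \<le> M * integral UNIV n" by linarith
  then show ?thesis unfolding Sn M_def n_def .
qed

section \<open>Finite propagation speed\<close>

text \<open>Here \<open>p i\<close>, \<open>pt i\<close> and \<open>pp i j\<close> stand for \<open>\<partial>\<^sub>i u\<close>, \<open>\<partial>\<^sub>t \<partial>\<^sub>i u\<close> and \<open>\<partial>\<^sub>j \<partial>\<^sub>i u\<close>.\<close>
locale wave_solution =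
  fixes K :: "real^2 \<Rightarrow> real" and dK :: "2 \<Rightarrow> real^2 \<Rightarrow> real"
    and u ut utt :: "real \<Rightarrow> real^2 \<Rightarrow> real"
    and p pt :: "2 \<Rightarrow> real \<Rightarrow> real^2 \<Rightarrow> real"
    and pp :: "2 \<Rightarrow> 2 \<Rightarrow> real \<Rightarrow> real^2 \<Rightarrow> real"
    and km r0 k0 \<rho> :: real
  assumes cont_K: "continuous_on UNIV K" and cont_dK: "\<And>i. continuous_on UNIV (dK i)"
    and deriv_K: "\<And>i x. ((\<lambda>h. K (x + h *\<^sub>R axis i 1)) has_real_derivative dK i x) (at 0)"
    and cont_u: "continuous_on ({0..} \<times> UNIV) (\<lambda>z. u (fst z) (snd z))"
    and cont_ut: "continuous_on ({0..} \<times> UNIV) (\<lambda>z. ut (fst z) (snd z))"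
    and cont_utt: "continuous_on ({0..} \<times> UNIV) (\<lambda>z. utt (fst z) (snd z))"
    and cont_p: "\<And>i. continuous_on ({0..} \<times> UNIV) (\<lambda>z. p i (fst z) (snd z))"
    and cont_pt: "\<And>i. continuous_on ({0..} \<times> UNIV) (\<lambda>z. pt i (fst z) (snd z))"
    and cont_pp: "\<And>i j. continuous_on ({0..} \<times> UNIV) (\<lambda>z. pp i j (fst z) (snd z))"
    and u_t: "\<And>t x. t > 0 \<Longrightarrow> ((\<lambda>t. u t x) has_real_derivative ut t x) (at t)"
    and u_x: "\<And>t x i. t > 0 \<Longrightarrow> ((\<lambda>h. u t (x + h *\<^sub>R axis i 1)) has_real_derivative p i t x) (at 0)"
    and ut_t: "\<And>t x. t > 0 \<Longrightarrow> ((\<lambda>t. ut t x) has_real_derivative utt t x) (at t)"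
    and ut_x: "\<And>t x i. t > 0 \<Longrightarrow> ((\<lambda>h. ut t (x + h *\<^sub>R axis i 1)) has_real_derivative pt i t x) (at 0)"
    and p_t: "\<And>t x i. t > 0 \<Longrightarrow> ((\<lambda>t. p i t x) has_real_derivative pt i t x) (at t)"
    and p_x: "\<And>t x i j. t > 0 \<Longrightarrow> ((\<lambda>h. p i t (x + h *\<^sub>R axis j 1)) has_real_derivative pp i j t x) (at 0)"
    and pp_sym: "\<And>t x i j. t > 0 \<Longrightarrow> pp i j t x = pp j i t x"
    and wave_eq: "\<And>t x. t > 0 \<Longrightarrow> utt t x = (\<Sum>i\<in>UNIV. dK i x * p i t x + K x * pp i i t x)"
    and km_pos: "km > 0" and K_ge: "\<And>x. K x \<ge> km"
    and r0_pos: "r0 > 0" and r0_le: "r0 \<le> \<rho>" and K_ext: "\<And>x. norm x > r0 \<Longrightarrow> K x = k0"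
    and u_init: "\<And>x. norm x > \<rho> \<Longrightarrow> u 0 x = 0" and ut_init: "\<And>x. norm x > \<rho> \<Longrightarrow> ut 0 x = 0"
    and p_init: "\<And>x i. norm x > \<rho> \<Longrightarrow> p i 0 x = 0"
begin

lemma k0_pos: "k0 > 0"
proof -
  have "norm ((r0 + 1) *\<^sub>R axis 1 1 :: real^2) > r0" using r0_pos by simp
  then show ?thesis using K_ext K_ge km_pos by (metis less_le_trans)
qed

lemma dK_ext: "norm x > r0 \<Longrightarrow> dK i x = 0"
proof -
  assume x: "norm x > r0"
  have "((\<lambda>h. K (x + h *\<^sub>R axis i 1) - k0) has_real_derivative dK i x) (at 0)"
    by (rule derivative_eq_intros deriv_K refl)+ simp
  then show ?thesis
    by (rule derivative_zero_if_locally_zero[where f="\<lambda>x. K x - k0" and S="- cball 0 r0"])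
      (use x K_ext in auto)
qed

lemma continuous_space_time:
  assumes "T \<subseteq> {0..}"
  shows "continuous_on (T \<times> UNIV) (\<lambda>z. u (fst z) (snd z))"
    "continuous_on (T \<times> UNIV) (\<lambda>z. ut (fst z) (snd z))"
    "continuous_on (T \<times> UNIV) (\<lambda>z. utt (fst z) (snd z))"
    "continuous_on (T \<times> UNIV) (\<lambda>z. p i (fst z) (snd z))"
    "continuous_on (T \<times> UNIV) (\<lambda>z. pt i (fst z) (snd z))"
    "continuous_on (T \<times> UNIV) (\<lambda>z. pp i j (fst z) (snd z))"
    "continuous_on (T \<times> UNIV) (\<lambda>z. K (snd z))"
    "continuous_on (T \<times> UNIV) (\<lambda>z. dK i (snd z))"
proof -
  have sub: "T \<times> UNIV \<subseteq> {0..} \<times> (UNIV :: (real^2) set)" using assms by auto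
  show "continuous_on (T \<times> UNIV) (\<lambda>z. u (fst z) (snd z))"
    "continuous_on (T \<times> UNIV) (\<lambda>z. ut (fst z) (snd z))"
    "continuous_on (T \<times> UNIV) (\<lambda>z. utt (fst z) (snd z))"
    "continuous_on (T \<times> UNIV) (\<lambda>z. p i (fst z) (snd z))"
    "continuous_on (T \<times> UNIV) (\<lambda>z. pt i (fst z) (snd z))"
    "continuous_on (T \<times> UNIV) (\<lambda>z. pp i j (fst z) (snd z))"
    using cont_u cont_ut cont_utt cont_p cont_pt cont_pp sub continuous_on_subset by blast+
  show "continuous_on (T \<times> UNIV) (\<lambda>z. K (snd z))" "continuous_on (T \<times> UNIV) (\<lambda>z. dK i (snd z))"
    by (auto intro!: continuous_on_compose2[OF cont_K] continuous_on_compose2[OF cont_dK] continuous_intros)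
qed

lemma continuous_space:
  assumes "0 \<le> t"
  shows "continuous_on UNIV (u t)" "continuous_on UNIV (ut t)" "continuous_on UNIV (utt t)"
    "continuous_on UNIV (p i t)" "continuous_on UNIV (pt i t)" "continuous_on UNIV (pp i j t)"
  using assms cont_u cont_ut cont_utt cont_p cont_pt cont_pp
  by (auto intro: continuous_on_slice[where U="{0..}"])

end

text \<open>Squaring makes the positive part differentiable across its zero set. A cutoff to a cone
  can then be a weight on the whole plane, without boundary terms on moving discs.\<close>

lemma has_real_derivative_max0_square:
  "((\<lambda>s::real. (max 0 s)\<^sup>2) has_real_derivative 2 * max 0 s) (at s)"
proof -
  consider "s < 0" | "s = 0" | "s > 0" by linarith
  then show ?thesis
  proof cases
    case 1
    have ev: "\<forall>\<^sub>F s in nhds s. (max 0 s)\<^sup>2 = (0::real)"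
      by (rule eventually_mono[OF eventually_nhds_in_open[of "{..<0}"]]) (use 1 in auto)
    show ?thesis unfolding DERIV_cong_ev[OF refl ev refl] using 1 by (auto intro!: derivative_eq_intros)
  next
    case 2
    \<comment> \<open>At 0 the difference quotient is \<open>max 0 z\<close> itself, which is
      continuous with value 0.\<close>
    have "isCont (\<lambda>z::real. max 0 z) 0" by (intro continuous_intros)
    moreover have "(max 0 z)\<^sup>2 - (max 0 0)\<^sup>2 = max 0 z * (z - 0)" for z :: real
      by (auto simp: max_def power2_eq_square)
    ultimately show ?thesis unfolding 2 CARAT_DERIV by (intro exI[of _ "\<lambda>z. max 0 z"]) auto
  next
    case 3
    have ev: "\<forall>\<^sub>F s in nhds s. (max 0 s)\<^sup>2 = s\<^sup>2"
      by (rule eventually_mono[OF eventually_nhds_in_open[of "{0<..}"]]) (use 3 in auto)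
    show ?thesis unfolding DERIV_cong_ev[OF refl ev refl] using 3 by (auto intro!: derivative_eq_intros)
  qed
qed

context wave_solution
begin

text \<open>The energy weighted by the square of the positive part of \<open>k0 (t0 - t)\<^sup>2 - |x - x0|\<^sup>2\<close>, a
  \<open>C\<^sup>1\<close> weight supported in the backward cone of \<open>(t0, x0)\<close>, is nonincreasing and starts at zero.
  The cone avoids the ball of radius \<open>\<rho>\<close>, so only the constant speed \<open>sqrt k0\<close> matters.\<close>
lemma ut_zero_in_cone:
  assumes x0: "norm x0 > \<rho> + sqrt k0 * t0" and t: "0 \<le> t" "t < t0"
  shows "ut t x0 = 0"
proof -
  define s where "s t x = k0 * (t0 - t)\<^sup>2 - ((x$1 - x0$1)\<^sup>2 + (x$2 - x0$2)\<^sup>2)" for t and x :: "real^2"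
  define D where "D t x = max 0 (s t x)" for t x
  define q where "q t x = (D t x)\<^sup>2 * (((ut t x)\<^sup>2 + k0 * ((p 1 t x)\<^sup>2 + (p 2 t x)\<^sup>2)) / 2)" for t x
  define q' where "q' t x = 2 * D t x * (- 2 * k0 * (t0 - t)) * (((ut t x)\<^sup>2 + k0 * ((p 1 t x)\<^sup>2 + (p 2 t x)\<^sup>2)) / 2)
     + (D t x)\<^sup>2 * (ut t x * utt t x + k0 * (p 1 t x * pt 1 t x + p 2 t x * pt 2 t x))" for t x
  define F where "F t i x = k0 * (D t x)\<^sup>2 * ut t x * p i t x" for t i x
  define F' where "F' t i x = k0 * (2 * D t x * (- 2 * (x$i - x0$i)) * ut t x * p i t x
     + (D t x)\<^sup>2 * (pt i t x * p i t x + ut t x * pp i i t x))" for t i x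
  \<comment> \<open>A radius containing every time slice of the cone for times between 0 and
    \<open>t0\<close>.\<close>
  define r where "r = norm x0 + sqrt k0 * t0"
  have Dcone: "norm x > \<rho>" "norm x \<le> r" "(x$1 - x0$1)\<^sup>2 + (x$2 - x0$2)\<^sup>2 \<le> k0 * (t0 - t)\<^sup>2"
    if "D t x \<noteq> 0" "0 \<le> t" "t \<le> t0" for t x
  proof -
    have "s t x > 0" using that(1) unfolding D_def by auto
    then have *: "(norm (x - x0))\<^sup>2 < k0 * (t0 - t)\<^sup>2" unfolding s_def norm_power2_vec2 by simp
    then show "(x$1 - x0$1)\<^sup>2 + (x$2 - x0$2)\<^sup>2 \<le> k0 * (t0 - t)\<^sup>2" unfolding norm_power2_vec2 by simp
    have "norm (x - x0) < sqrt (k0 * (t0 - t)\<^sup>2)" using * real_less_rsqrt by blast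
    also have "\<dots> = sqrt k0 * (t0 - t)" using that by (simp add: real_sqrt_mult)
    finally have n: "norm (x - x0) < sqrt k0 * t0 - sqrt k0 * t" by (simp add: algebra_simps)
    have "sqrt k0 * t \<ge> 0" using that k0_pos by simp
    then show "norm x > \<rho>" "norm x \<le> r"
      using n x0 norm_triangle_ineq2[of x0 x] norm_triangle_ineq2[of x x0] norm_minus_commute[of x0 x]
      unfolding r_def by linarith+
  qed
  have s_t: "((\<lambda>t. s t x) has_real_derivative - 2 * k0 * (t0 - t)) (at t)" for t x
    unfolding s_def by (rule derivative_eq_intros refl)+ (simp add: algebra_simps)
  note [derivative_intros] = has_real_derivative_coordinate
  have s_x: "((\<lambda>h. s t (x + h *\<^sub>R axis i 1)) has_real_derivative - 2 * (x$i - x0$i)) (at 0)" for t x i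
    unfolding s_def by (rule derivative_eq_intros refl)+ (use exhaust_2[of i] in auto)
  have D_t: "((\<lambda>t. (D t x)\<^sup>2) has_real_derivative 2 * D t x * (- 2 * k0 * (t0 - t))) (at t)" for t x
    unfolding D_def by (rule DERIV_chain2[OF has_real_derivative_max0_square s_t])
  have D_x: "((\<lambda>h. (D t (x + h *\<^sub>R axis i 1))\<^sup>2) has_real_derivative 2 * D t x * (- 2 * (x$i - x0$i))) (at 0)" for t x i
    unfolding D_def
    using DERIV_chain2[OF has_real_derivative_max0_square s_x[of t x i]] by simp
  have cD: "continuous_on (T \<times> UNIV) (\<lambda>z. D (fst z) (snd z))" for T
    unfolding D_def s_def by (intro continuous_intros)
  have cDx: "continuous_on UNIV (D t)" for t
    unfolding D_def s_def by (intro continuous_intros)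
  note ci = continuous_intros continuous_space_time continuous_space cD cDx
  have q_t: "((\<lambda>t. q t x) has_real_derivative q' t x) (at t)" if "t > 0" for t x
    unfolding q_def q'_def
    by (rule D_t ut_t[OF that] p_t[OF that] derivative_eq_intros refl zero_neq_numeral[symmetric])+ (simp add: algebra_simps)
  have F_x: "((\<lambda>h. F t i (x + h *\<^sub>R axis i 1)) has_real_derivative F' t i x) (at 0)" if "t > 0" for t i x
    unfolding F_def F'_def
    by (rule D_x ut_x[OF that] p_x[OF that] derivative_eq_intros refl)+ (simp add: algebra_simps)
  have le0: "q' t x - (\<Sum>i\<in>UNIV. F' t i x) \<le> 0" if t: "0 < t" "t < t0" for t x
  proof (cases "D t x = 0")
    case True then show ?thesis by (simp add: q'_def F'_def)
  next
    case False
    have D0: "D t x > 0" using False unfolding D_def by auto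
    define y where "y = (x$1 - x0$1) * p 1 t x + (x$2 - x0$2) * p 2 t x"
    define n where "n = (p 1 t x)\<^sup>2 + (p 2 t x)\<^sup>2"
    define \<tau> where "\<tau> = t0 - t"
    have \<tau>: "\<tau> > 0" using t unfolding \<tau>_def by simp
    have ext: "norm x > r0" using Dcone(1)[OF False] t r0_le by auto
    have "utt t x = k0 * (pp 1 1 t x + pp 2 2 t x)"
      using wave_eq[OF t(1), of x] K_ext[OF ext] dK_ext[OF ext] by (simp add: sum_2 algebra_simps)
    \<comment> \<open>The terms with the factor \<open>D\<^sup>2\<close> cancel by the wave equation
      with constant speed; the rest stems from differentiating the weight.\<close>
    then have eq: "q' t x - (\<Sum>i\<in>UNIV. F' t i x) = - (2 * k0 * D t x) * (\<tau> * ((ut t x)\<^sup>2 + k0 * n) - 2 * ut t x * y)"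
      unfolding q'_def F'_def y_def n_def \<tau>_def by (simp add: sum_2 field_simps power2_eq_square)
    have "y\<^sup>2 \<le> ((x$1 - x0$1)\<^sup>2 + (x$2 - x0$2)\<^sup>2) * n"
    proof -
      have "((x$1 - x0$1)\<^sup>2 + (x$2 - x0$2)\<^sup>2) * n - y\<^sup>2 = ((x$1 - x0$1) * p 2 t x - (x$2 - x0$2) * p 1 t x)\<^sup>2"
        unfolding y_def n_def by (simp add: algebra_simps power2_eq_square)
      then show ?thesis by (smt (verit) zero_le_power2)
    qed
    also have "\<dots> \<le> (k0 * \<tau>\<^sup>2) * n"
      using Dcone(3)[OF False] t unfolding n_def \<tau>_def by (intro mult_right_mono) auto
    finally have yn: "y\<^sup>2 \<le> k0 * \<tau>\<^sup>2 * n" .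
    \<comment> \<open>Multiplying by \<tau> > 0 completes the square, and the remainder is
      nonnegative exactly because x lies in the cone.\<close>
    have "\<tau> * (\<tau> * ((ut t x)\<^sup>2 + k0 * n) - 2 * ut t x * y) = (\<tau> * ut t x - y)\<^sup>2 + (k0 * \<tau>\<^sup>2 * n - y\<^sup>2)"
      by (simp add: algebra_simps power2_eq_square)
    then have "\<tau> * (\<tau> * ((ut t x)\<^sup>2 + k0 * n) - 2 * ut t x * y) \<ge> 0" using yn by simp
    then have "\<tau> * ((ut t x)\<^sup>2 + k0 * n) - 2 * ut t x * y \<ge> 0" using \<tau> by (simp add: zero_le_mult_iff)
    then show ?thesis unfolding eq using D0 k0_pos by simp
  qed
  have q_out: "q t x = 0" and F_out: "F t i x = 0" if "0 \<le> t" "t \<le> t0" "norm x > r" for t x i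
    using Dcone(2)[of t x] that unfolding q_def F_def by fastforce+
  define Q where "Q t = integral UNIV (q t)" for t
  have Q': "\<exists>y. (Q has_real_derivative y) (at t) \<and> y \<le> 0" if t: "0 < t" "t < t0" for t
  proof (intro exI conjI)
    show "(Q has_real_derivative integral UNIV (\<lambda>x. q' t x - (\<Sum>i\<in>UNIV. F' t i x))) (at t)"
      unfolding Q_def
    proof (rule balance_law[OF t])
      show "continuous_on UNIV (q s)" if "0 < s" for s
        unfolding q_def using that by (intro ci) auto
      show "continuous_on ({0<..<t0} \<times> UNIV) (\<lambda>z. q' (fst z) (snd z))"
        unfolding q'_def by (intro ci) auto
      show "continuous_on UNIV (F t i)" "continuous_on UNIV (F' t i)" for i
        unfolding F_def F'_def using t by (intro ci; simp)+
      show "((\<lambda>h. F t i (x + h *\<^sub>R axis i 1)) has_real_derivative F' t i x) (at 0)" for i x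
        by (rule F_x[OF t(1)])
    qed (use q_t t in \<open>auto intro!: q_out F_out\<close>)
    show "integral UNIV (\<lambda>x. q' t x - (\<Sum>i\<in>UNIV. F' t i x)) \<le> 0"
    proof (cases "(\<lambda>x. q' t x - (\<Sum>i\<in>UNIV. F' t i x)) integrable_on UNIV")
      case True
      have "integral UNIV (\<lambda>x. q' t x - (\<Sum>i\<in>UNIV. F' t i x)) \<le> integral UNIV (\<lambda>x::real^2. 0)"
        by (rule integral_le[OF True integrable_0 le0[OF t]])
      then show ?thesis by simp
    \<comment> \<open>The integral of a non-integrable function is 0 by convention, so the sign
      holds in this case as well.\<close>
    qed (simp add: not_integrable_integral)
  qed
  have Qr: "Q t = integral (centred_cube r) (q t)" if "0 \<le> t" "t \<le> t0" for t
    unfolding Q_def by (rule integral_UNIV_eq_cube) (use q_out that in auto)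
  \<comment> \<open>The derivative of Q is known only for positive times; continuity at 0 connects
    it with the initial data.\<close>
  have "continuous_on {0..t0} (\<lambda>t. integral (centred_cube r) (q t))"
    unfolding centred_cube_def
  proof (rule integral_continuous_on_param)
    have "continuous_on ({0..t0} \<times> UNIV) (\<lambda>z. q (fst z) (snd z))"
      unfolding q_def by (intro ci) auto
    then show "continuous_on ({0..t0} \<times> cbox (\<chi> i. - r) (\<chi> i. r)) (\<lambda>(t, x). q t x)"
      unfolding split_beta by (rule continuous_on_subset) auto
  qed
  then have cQ: "continuous_on {0..t0} Q" by (rule continuous_on_eq) (use Qr in auto)
  have "Q t \<le> Q 0"
  proof (cases "t = 0")
    case False
    show ?thesis
      by (rule DERIV_nonpos_imp_decreasing_open[of 0 t Q])
        (use t Q' False in \<open>auto intro: continuous_on_subset[OF cQ]\<close>)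
  qed simp
  also have "Q 0 = 0"
  proof -
    have "q 0 x = 0" for x
      using Dcone(1)[of 0 x] ut_init[of x] p_init[of x] t unfolding q_def by (cases "D 0 x = 0") auto
    then have "q 0 = (\<lambda>x. 0)" by auto
    then show ?thesis unfolding Q_def by simp
  qed
  finally have "integral (centred_cube r) (q t) \<le> 0" using Qr t by simp
  moreover have cq: "continuous_on (centred_cube r) (q t)"
    unfolding q_def by (rule continuous_on_subset[where s=UNIV], intro ci) (use t in auto)
  have q0: "q t x \<ge> 0" for x unfolding q_def using k0_pos by simp
  moreover have "integral (centred_cube r) (q t) \<ge> 0"
    by (rule integral_nonneg)
      (use cq q0 in \<open>auto simp: centred_cube_def intro!: integrable_continuous\<close>)
  ultimately have I0: "integral (centred_cube r) (q t) = 0" by simp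
  have r_pos: "r > 0" unfolding r_def
    using x0 r0_pos r0_le t k0_pos by (smt (verit) mult_nonneg_nonneg real_sqrt_ge_zero)
  have "box (\<chi> i. - r) (\<chi> i. r) \<noteq> ({} :: (real^2) set)"
  proof -
    have "(0::real^2) \<in> box (\<chi> i. - r) (\<chi> i. r)" using r_pos by (simp add: mem_box_cart)
    then show ?thesis by blast
  qed
  then have "\<forall>x\<in>centred_cube r. q t x = 0"
    using integral_cbox_eq_0_iff[of "\<chi> i. - r" "\<chi> i. r" "q t"] cq q0 I0 unfolding centred_cube_def by auto
  moreover have "x0 \<in> centred_cube r"
    using cball_subset_centred_cube[of r] t k0_pos unfolding r_def by (force simp: mem_cball)
  ultimately have "q t x0 = 0" by blast
  \<comment> \<open>On the axis of the cone the weight is \<open>k0 * (t0 - t)\<^sup>2\<close>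
    before squaring, positive strictly before the vertex time.\<close>
  moreover have "D t x0 > 0" unfolding D_def s_def using t k0_pos by simp
  ultimately have "(ut t x0)\<^sup>2 + k0 * ((p 1 t x0)\<^sup>2 + (p 2 t x0)\<^sup>2) = 0" unfolding q_def by simp
  moreover have "k0 * ((p 1 t x0)\<^sup>2 + (p 2 t x0)\<^sup>2) \<ge> 0" using k0_pos by simp
  ultimately have "(ut t x0)\<^sup>2 = 0" by (smt (verit) zero_le_power2)
  then show ?thesis by simp
qed

text \<open>The segment from (0, x) to (t, x) is the axis of the cone with vertex (t, x), so
  \<open>ut\<close> vanishes along it and u keeps its initial value 0.\<close>

lemma u_finite_speed:
  assumes t: "0 < t" and x: "norm x > \<rho> + sqrt k0 * t"
  shows "u t x = 0"
proof -
  have c: "continuous_on {0..t} (\<lambda>s. u s x)"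
    by (rule continuous_on_slice_fst[where V=UNIV]) (auto intro!: continuous_space_time)
  have "((\<lambda>s. u s x) has_real_derivative 0) (at s)" if "0 < s" "s < t" for s
    using u_t[OF that(1), of x] ut_zero_in_cone[OF x, of s] that by simp
  then have "u t x = u 0 x"
    using DERIV_isconst_end[OF t c] by auto
  also have "\<dots> = 0"
    by (rule u_init) (use x t k0_pos in \<open>smt (verit) mult_nonneg_nonneg real_sqrt_ge_zero\<close>)
  finally show ?thesis .
qed

lemma p_finite_speed:
  assumes t: "0 < t" and x: "norm x > \<rho> + sqrt k0 * t"
  shows "p i t x = 0"
  by (rule derivative_zero_if_locally_zero[OF u_x[OF t], of "- cball 0 (\<rho> + sqrt k0 * t)"])
    (use t x u_finite_speed in auto)

lemma ut_finite_speed: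
  assumes t: "0 < t" and x: "norm x > \<rho> + sqrt k0 * t"
  shows "ut t x = 0"
proof -
  define S where "S = {s. norm x > \<rho> + sqrt k0 * s} \<inter> {0<..}"
  have "open S" unfolding S_def by (intro open_Int open_Collect_less continuous_intros)
  then have ev: "\<forall>\<^sub>F s in nhds t. u s x = 0"
    by (rule eventually_mono[OF eventually_nhds_in_open]) (use t x u_finite_speed in \<open>auto simp: S_def\<close>)
  have "((\<lambda>s. 0) has_real_derivative ut t x) (at t)"
    using DERIV_cong_ev[OF refl ev refl] u_t[OF t] by blast
  then show ?thesis using DERIV_unique DERIV_const by blast
qed

end

section \<open>Energy estimates\<close>

context wave_solution
begin

definition energy_density :: "real \<Rightarrow> real^2 \<Rightarrow> real" where
  "energy_density t x = ((ut t x)\<^sup>2 + K x * ((p 1 t x)\<^sup>2 + (p 2 t x)\<^sup>2)) / 2"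

text \<open>The multiplier \<open>x . grad u\<close> alone would produce minus the integral of
  \<open>ut\<^sup>2\<close>. The summand \<open>u / 2\<close> adds half of the integral of
  \<open>ut\<^sup>2 - K |grad u|\<^sup>2\<close>, which turns this into minus the full
  energy.\<close>

definition virial_density :: "real \<Rightarrow> real^2 \<Rightarrow> real" where
  "virial_density t x = ut t x * (x$1 * p 1 t x + x$2 * p 2 t x + u t x / 2)"

definition drift_density :: "real \<Rightarrow> real^2 \<Rightarrow> real" where
  "drift_density t x = (x$1 * dK 1 x + x$2 * dK 2 x) * ((p 1 t x)\<^sup>2 + (p 2 t x)\<^sup>2) / 2"

definition support_radius :: "real \<Rightarrow> real" where
  "support_radius t = \<rho> + sqrt k0 * t"

lemma support_radius_mono: "s \<le> t \<Longrightarrow> support_radius s \<le> support_radius t"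
  using k0_pos by (simp add: support_radius_def)

lemma vanish:
  assumes "0 < t" "norm x > support_radius T" "t \<le> T"
  shows "u t x = 0" "ut t x = 0" "p i t x = 0"
  using u_finite_speed[of t x] ut_finite_speed[of t x] p_finite_speed[of t x] support_radius_mono[of t T] assms
  unfolding support_radius_def by auto

lemmas cont_intros = continuous_intros continuous_space_time continuous_space cont_K cont_dK

lemma K_pos: "K x > 0"
  using K_ge[of x] km_pos by linarith

lemma energy_density_nonneg: "0 \<le> energy_density t x"
  unfolding energy_density_def using K_pos[of x] by simp

lemma densities_continuous:
  assumes "0 \<le> t"
  shows "continuous_on UNIV (energy_density t)" "continuous_on UNIV (virial_density t)"
    "continuous_on UNIV (drift_density t)" "continuous_on UNIV (\<lambda>x. (u t x)\<^sup>2)"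
  unfolding energy_density_def virial_density_def drift_density_def
  by (intro cont_intros assms; simp)+

lemma densities_integrable:
  assumes "0 < t"
  shows "energy_density t integrable_on UNIV" "virial_density t integrable_on UNIV"
    "drift_density t integrable_on UNIV" "(\<lambda>x. (u t x)\<^sup>2) integrable_on UNIV"
proof -
  note * = integrable_UNIV_compact_support[where r="support_radius t"]
  note v = vanish[OF assms, of t]
  show "energy_density t integrable_on UNIV" "virial_density t integrable_on UNIV"
    "drift_density t integrable_on UNIV" "(\<lambda>x. (u t x)\<^sup>2) integrable_on UNIV"
    by (rule *, use assms densities_continuous[of t] in simp,
        simp add: energy_density_def virial_density_def drift_density_def v)+
qed

lemma energy_conserved:
  assumes t: "0 < t"
  shows "((\<lambda>t. integral UNIV (energy_density t)) has_real_derivative 0) (at t)"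
proof -
  define q' where "q' t x = ut t x * utt t x + K x * (p 1 t x * pt 1 t x + p 2 t x * pt 2 t x)" for t x
  define F where "F i x = K x * ut t x * p i t x" for i x
  define F' where "F' i x = dK i x * ut t x * p i t x + K x * (pt i t x * p i t x + ut t x * pp i i t x)" for i x
  define r where "r = support_radius (t + 1)"
  have q_t: "((\<lambda>t. energy_density t x) has_real_derivative q' t x) (at t)" if "t > 0" for t x
    unfolding energy_density_def q'_def
    by (rule ut_t[OF that] p_t[OF that] derivative_eq_intros refl zero_neq_numeral[symmetric])+ (simp add: algebra_simps)
  have F_x: "((\<lambda>h. F i (x + h *\<^sub>R axis i 1)) has_real_derivative F' i x) (at 0)" for i x
    unfolding F_def F'_def
    by (rule deriv_K ut_x[OF t] p_x[OF t] derivative_eq_intros refl)+ (simp add: algebra_simps)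
  have eq: "q' t x - (\<Sum>i\<in>UNIV. F' i x) = 0" for x
    using wave_eq[OF t, of x] unfolding q'_def F'_def by (simp add: sum_2 algebra_simps)
  have "((\<lambda>t. integral UNIV (energy_density t)) has_real_derivative integral UNIV (\<lambda>x. q' t x - (\<Sum>i\<in>UNIV. F' i x))) (at t)"
  proof (rule balance_law[where a=0 and b="t+1" and r=r])
    show "continuous_on ({0<..<t+1} \<times> UNIV) (\<lambda>z. q' (fst z) (snd z))"
      unfolding q'_def by (intro cont_intros) auto
    show "continuous_on UNIV (F i)" "continuous_on UNIV (F' i)" for i
      unfolding F_def F'_def using t by (intro cont_intros; simp)+
    show "energy_density s x = 0" if "0 < s" "s < t + 1" "norm x > r" for s x
      using vanish[of s "t+1" x] that unfolding r_def energy_density_def by simp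
    show "F i x = 0" if "norm x > r" for i x
      using vanish[OF t, of "t+1" x] that unfolding r_def F_def by simp
  qed (use t in \<open>auto intro: q_t F_x densities_continuous\<close>)
  then show ?thesis unfolding eq by simp
qed

lemma virial_identity:
  assumes t: "0 < t"
  shows "((\<lambda>t. integral UNIV (virial_density t)) has_real_derivative
     integral UNIV (drift_density t) - integral UNIV (energy_density t)) (at t)"
proof -
  define q' where "q' t x = utt t x * (x$1 * p 1 t x + x$2 * p 2 t x + u t x / 2)
     + ut t x * (x$1 * pt 1 t x + x$2 * pt 2 t x + ut t x / 2)" for t x
  define F where "F i x = K x * p i t x * (x$1 * p 1 t x + x$2 * p 2 t x + u t x / 2)
     + x$i * ((ut t x)\<^sup>2 - K x * ((p 1 t x)\<^sup>2 + (p 2 t x)\<^sup>2)) * (1/2)" for i x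
  define F' where "F' i x = (dK i x * p i t x + K x * pp i i t x) * (x$1 * p 1 t x + x$2 * p 2 t x + u t x / 2)
     + K x * p i t x * (p i t x + x$1 * pp 1 i t x + x$2 * pp 2 i t x + p i t x / 2)
     + ((ut t x)\<^sup>2 - K x * ((p 1 t x)\<^sup>2 + (p 2 t x)\<^sup>2)) * (1/2)
     + x$i * (ut t x * pt i t x - dK i x * ((p 1 t x)\<^sup>2 + (p 2 t x)\<^sup>2) * (1/2)
       - K x * (p 1 t x * pp 1 i t x + p 2 t x * pp 2 i t x))" for i x
  define r where "r = support_radius (t + 1)"
  have q_t: "((\<lambda>t. virial_density t x) has_real_derivative q' t x) (at t)" if "t > 0" for t x
    unfolding virial_density_def q'_def
    by (rule u_t[OF that] ut_t[OF that] p_t[OF that] derivative_eq_intros refl zero_neq_numeral[symmetric])+ (simp add: algebra_simps)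
  have F_x: "((\<lambda>h. F i (x + h *\<^sub>R axis i 1)) has_real_derivative F' i x) (at 0)" for i x
    unfolding F_def F'_def
    by (rule has_real_derivative_coordinate deriv_K u_x[OF t] ut_x[OF t] p_x[OF t]
        derivative_eq_intros refl zero_neq_numeral[symmetric])+
      (use exhaust_2[of i] in \<open>auto simp: field_simps power2_eq_square\<close>)
  \<comment> \<open>Symmetry of the second derivatives makes the terms
    \<open>K * p i * x$j * pp j i\<close> coming from the multiplier cancel those from the gradient
    of \<open>K |grad u|\<^sup>2 / 2\<close>.\<close>
  have eq: "q' t x - (\<Sum>i\<in>UNIV. F' i x) = drift_density t x - energy_density t x" for x
    using wave_eq[OF t, of x] pp_sym[OF t, of 1 2 x]
    unfolding q'_def F'_def drift_density_def energy_density_def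
    by (simp add: sum_2 field_simps power2_eq_square)
  have "((\<lambda>t. integral UNIV (virial_density t)) has_real_derivative integral UNIV (\<lambda>x. q' t x - (\<Sum>i\<in>UNIV. F' i x))) (at t)"
  proof (rule balance_law[where a=0 and b="t+1" and r=r])
    show "continuous_on ({0<..<t+1} \<times> UNIV) (\<lambda>z. q' (fst z) (snd z))"
      unfolding q'_def by (intro cont_intros) auto
    show "continuous_on UNIV (F i)" "continuous_on UNIV (F' i)" for i
      unfolding F_def F'_def using t by (intro cont_intros; simp)+
    show "virial_density s x = 0" if "0 < s" "s < t + 1" "norm x > r" for s x
      using vanish[of s "t+1" x] that unfolding r_def virial_density_def by simp
    show "F i x = 0" if "norm x > r" for i x
      using vanish[OF t, of "t+1" x] that unfolding r_def F_def by simp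
  qed (use t in \<open>auto intro: q_t F_x densities_continuous\<close>)
  then show ?thesis unfolding eq
    by (simp add: integral_diff densities_integrable[OF t])
qed

section \<open>Logarithmic growth of the L2 norm\<close>

text \<open>The constant of \<open>log_hardy_inequality\<close> for a disc that contains the support
  at time t.\<close>

definition log_factor :: "real \<Rightarrow> real" where
  "log_factor t = 1 + ln (1 + (support_radius t)\<^sup>2)"

lemma log_factor_ge_1: "1 \<le> log_factor t"
  unfolding log_factor_def by simp

lemma log_factor_mono:
  assumes "0 \<le> s" "s \<le> t"
  shows "log_factor s \<le> log_factor t"
proof -
  have "0 \<le> support_radius s"
    unfolding support_radius_def using r0_pos r0_le assms k0_pos by simp
  then have "(support_radius s)\<^sup>2 \<le> (support_radius t)\<^sup>2"
    using support_radius_mono[OF assms(2)] by (intro power_mono)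
  then show ?thesis unfolding log_factor_def
    by (simp add: add_pos_nonneg)
qed

text \<open>The primitive \<open>v = \<integral>\<^bsub>a\<^esub>\<^bsup>t\<^esup> u\<close> solves \<open>\<nabla> \<cdot> (K \<nabla>v) = u\<^sub>t - u\<^sub>t(a)\<close>, so its energy identity controls
  \<open>\<parallel>u\<parallel>\<^sup>2\<close> by \<open>\<integral> u\<^sub>t(a) v\<close>, which the logarithmic Hardy inequality absorbs into \<open>\<parallel>\<nabla>v\<parallel>\<^sup>2\<close>.\<close>
lemma L2_norm_log_growth:
  "\<exists>C\<ge>0. \<forall>t\<ge>1. integral UNIV (\<lambda>x. (u t x)\<^sup>2) \<le> C * log_factor t"
proof -
  \<comment> \<open>Positive, because the derivatives are available only at positive times, and
    below 1, so that the conserved quantity is differentiable on all of t \<ge> 1.\<close>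
  define a :: real where "a = 1/2"
  have a: "0 < a" "a < 1" unfolding a_def by auto
  have a_sub: "{a..} \<subseteq> {0..}" using a by auto
  define v where "v t x = integral {a..t} (\<lambda>s. u s x)" for t x
  define w where "w i t x = integral {a..t} (\<lambda>s. p i s x)" for i t x
  define ww where "ww i t x = integral {a..t} (\<lambda>s. pp i i s x)" for i t x
  note cs = continuous_space_time[OF a_sub]
  have cv0: "continuous_on ({a..} \<times> UNIV) (\<lambda>z. v (fst z) (snd z))"
    and cw0: "continuous_on ({a..} \<times> UNIV) (\<lambda>z. w i (fst z) (snd z))"
    and cww0: "continuous_on ({a..} \<times> UNIV) (\<lambda>z. ww i (fst z) (snd z))" for i
    unfolding v_def w_def ww_def by (intro continuous_on_antiderivative cs)+
  have cv: "continuous_on UNIV (v t)" and cw: "continuous_on UNIV (w i t)"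
    and cww: "continuous_on UNIV (ww i t)" if "a \<le> t" for t i
    using that by (auto intro: continuous_on_slice[OF cv0] continuous_on_slice[OF cw0] continuous_on_slice[OF cww0])
  have cv1: "continuous_on (T \<times> UNIV) (\<lambda>z. v (fst z) (snd z))"
    and cw1: "continuous_on (T \<times> UNIV) (\<lambda>z. w i (fst z) (snd z))" if "T \<subseteq> {a..}" for T i
    by (rule continuous_on_subset[OF cv0] continuous_on_subset[OF cw0], use that in blast)+
  have v_t: "((\<lambda>t. v t x) has_real_derivative u t x) (at t)"
    and w_t: "((\<lambda>t. w i t x) has_real_derivative p i t x) (at t)" if "a < t" for t x i
    unfolding v_def w_def
    by (rule antiderivative_time_derivative[OF continuous_on_slice_fst[OF cs(1)]]
        antiderivative_time_derivative[OF continuous_on_slice_fst[OF cs(4)]], simp, rule that)+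
  have v_x: "((\<lambda>h. v t (x + h *\<^sub>R axis i 1)) has_real_derivative w i t x) (at 0)"
    and w_x: "((\<lambda>h. w i t (x + h *\<^sub>R axis i 1)) has_real_derivative ww i t x) (at 0)" for t x i
    unfolding v_def w_def ww_def
    by (rule antiderivative_directional_derivative; (intro cs u_x p_x; (use a in linarith)?))+
  have v0: "v t x = 0" and w0: "w i t x = 0" if "norm x > support_radius T" "t \<le> T" for t T x i
  proof -
    have z: "u s x = 0" "p i s x = 0" if "s \<in> {a..t}" for s
      using vanish[of s T x] that \<open>norm x > support_radius T\<close> \<open>t \<le> T\<close> a by auto
    have "v t x = integral {a..t} (\<lambda>s. 0)" "w i t x = integral {a..t} (\<lambda>s. 0)"
      unfolding v_def w_def by (rule integral_cong, rule z, assumption)+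
    then show "v t x = 0" "w i t x = 0" by auto
  qed
  have div: "(\<Sum>i\<in>UNIV. dK i x * w i t x + K x * ww i t x) = ut t x - ut a x" if t: "a < t" for t x
  proof -
    have i1: "(\<lambda>s. p i s x) integrable_on {a..t}" and i2: "(\<lambda>s. pp i i s x) integrable_on {a..t}" for i
      by (rule integrable_continuous_interval, rule continuous_on_subset[where s="{a..}"],
          rule continuous_on_slice_fst[OF cs(4)] continuous_on_slice_fst[OF cs(6)], auto)+
    have "((\<lambda>s. \<Sum>i\<in>UNIV. dK i x * p i s x + K x * pp i i s x) has_integral
        (\<Sum>i\<in>UNIV. dK i x * w i t x + K x * ww i t x)) {a..t}"
      unfolding w_def ww_def
      by (intro has_integral_sum has_integral_add has_integral_mult_right integrable_integral i1 i2) auto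
    then have "((\<lambda>s. utt s x) has_integral (\<Sum>i\<in>UNIV. dK i x * w i t x + K x * ww i t x)) {a..t}"
      by (rule has_integral_eq[rotated]) (use wave_eq a in auto)
    moreover have "((\<lambda>s. utt s x) has_integral (ut t x - ut a x)) {a..t}"
    proof (rule fundamental_theorem_of_calculus)
      show "((\<lambda>s. ut s x) has_vector_derivative utt s x) (at s within {a..t})" if "s \<in> {a..t}" for s
        unfolding has_real_derivative_iff_has_vector_derivative[symmetric]
        by (rule has_field_derivative_at_within, rule ut_t) (use that a in auto)
    qed (use t in simp)
    ultimately show ?thesis by (rule has_integral_unique)
  qed
  \<comment> \<open>The primitive solves \<open>v_tt - div (K grad v) = ut a\<close> with a source
    independent of time. Subtracting \<open>ut a * v\<close>, the potential of this source, makes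
    the energy of v exactly conserved.\<close>
  define q where "q t x = ((u t x)\<^sup>2 + K x * ((w 1 t x)\<^sup>2 + (w 2 t x)\<^sup>2)) / 2 - ut a x * v t x" for t x
  define q' where "q' t x = u t x * ut t x + K x * (w 1 t x * p 1 t x + w 2 t x * p 2 t x) - ut a x * u t x" for t x
  define F where "F t i x = K x * u t x * w i t x" for t i x
  define F' where "F' t i x = dK i x * u t x * w i t x + K x * (p i t x * w i t x + u t x * ww i t x)" for t i x
  define N where "N t = integral UNIV (q t)" for t
  have cuta: "continuous_on (T \<times> UNIV) (\<lambda>z. ut a (snd z))" for T :: "real set"
    by (rule continuous_on_compose2[OF continuous_space(2)]) (use a in \<open>auto intro!: continuous_intros\<close>)
  note ci = cont_intros cv cw cww cv1 cw1 cuta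
  have q_t: "((\<lambda>t. q t x) has_real_derivative q' t x) (at t)" if "a < t" for t x
    unfolding q_def q'_def
    by (rule u_t[OF less_trans[OF a(1) that]] w_t[OF that] v_t[OF that] derivative_eq_intros refl
        zero_neq_numeral[symmetric])+ (simp add: algebra_simps)
  have cq: "continuous_on UNIV (q t)" if "a < t" for t
    unfolding q_def by (intro ci) (use that a in auto)
  have qs: "q s x = 0" if "a < s" "s \<le> T" "norm x > support_radius T" for s x T
    unfolding q_def using vanish(1)[of s T x] w0[of T x s] v0[of T x s] that a by simp
  have N': "(N has_real_derivative 0) (at t)" if t: "a < t" for t
  proof -
    have t0: "0 < t" using t a by simp
    have eq: "q' t x - (\<Sum>i\<in>UNIV. F' t i x) = 0" for x
    proof -
      have "(\<Sum>i\<in>UNIV. F' t i x) = u t x * (\<Sum>i\<in>UNIV. dK i x * w i t x + K x * ww i t x)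
          + K x * (w 1 t x * p 1 t x + w 2 t x * p 2 t x)"
        unfolding F'_def by (simp add: sum_2 algebra_simps)
      then show ?thesis unfolding div[OF t] q'_def by (simp add: algebra_simps)
    qed
    have "(N has_real_derivative integral UNIV (\<lambda>x. q' t x - (\<Sum>i\<in>UNIV. F' t i x))) (at t)"
      unfolding N_def
    proof (rule balance_law[where a=a and b="t+1" and r="support_radius (t+1)"])
      show "continuous_on ({a<..<t+1} \<times> UNIV) (\<lambda>z. q' (fst z) (snd z))"
        unfolding q'_def by (intro ci) (use a in auto)
      show "continuous_on UNIV (F t i)" "continuous_on UNIV (F' t i)" for i
        unfolding F_def F'_def using t a by (intro ci; simp)+
      show "F t i x = 0" if "norm x > support_radius (t+1)" for i x
        using vanish[OF t0, of "t+1" x] that unfolding F_def by simp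
      show "((\<lambda>h. F t i (x + h *\<^sub>R axis i 1)) has_real_derivative F' t i x) (at 0)" for i x
        unfolding F_def F'_def
        by (rule deriv_K u_x[OF t0] w_x derivative_eq_intros refl)+ (simp add: algebra_simps)
      show "q s x = 0" if "a < s" "s < t + 1" "norm x > support_radius (t+1)" for s x
        using qs[of s "t+1" x] that by simp
    qed (use t in \<open>auto intro: q_t cq\<close>)
    then show ?thesis unfolding eq by simp
  qed
  have N1: "N t = N 1" if "1 \<le> t" for t
  proof (rule DERIV_isconst2[of 1 "t+1"])
    show "continuous_on {1..t+1} N"
      by (rule DERIV_continuous_on[where D="\<lambda>_. 0"], rule has_field_derivative_at_within, rule N')
        (use a in auto)
  qed (use that N' a in auto)
  define C1 where "C1 = integral UNIV (\<lambda>x. (ut a x)\<^sup>2 * (1 + (norm x)\<^sup>2)\<^sup>2)"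
  have uta_int: "(\<lambda>x. (ut a x)\<^sup>2 * (1 + (norm x)\<^sup>2)\<^sup>2) integrable_on UNIV"
    by (rule integrable_UNIV_compact_support[where r="support_radius a"], intro cont_intros)
      (use a vanish(2)[OF a(1), of a] in auto)
  have C1: "C1 \<ge> 0" unfolding C1_def by (rule integral_nonneg[OF uta_int]) simp
  have bound: "integral UNIV (\<lambda>x. (u t x)\<^sup>2) \<le> (2 * \<bar>N 1\<bar> + C1 / km) * log_factor t" if t: "1 \<le> t" for t
  proof -
    define M where "M = log_factor t"
    have M: "M \<ge> 1" unfolding M_def by (rule log_factor_ge_1)
    have at: "a < t" "a \<le> t" "0 < t" using t a by auto
    have v_supp: "v t x = 0" if "norm x > support_radius t" for x
      by (rule v0) (use that in auto)
    have w_supp: "w i t x = 0" if "norm x > support_radius t" for x i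
      by (rule w0) (use that in auto)
    have ntn: "1 + (norm x)\<^sup>2 \<noteq> 0" for x :: "real^2" by (smt (verit) zero_le_power2)
    have int_w: "(\<lambda>x. \<Sum>i\<in>UNIV. (w i t x)\<^sup>2) integrable_on UNIV"
      by (rule integrable_UNIV_compact_support[where r="support_radius t"], intro ci at)
        (simp add: w_supp)
    have int_v: "(\<lambda>x. (v t x)\<^sup>2 / (1 + (norm x)\<^sup>2)\<^sup>2) integrable_on UNIV"
      by (rule integrable_UNIV_compact_support[where r="support_radius t"], intro ci at)
        (use ntn v_supp in auto)
    have int_q: "q t integrable_on UNIV"
      by (rule integrable_UNIV_compact_support[OF cq[OF at(1)], of "support_radius t"]) (use qs at in auto)
    have hardy: "integral UNIV (\<lambda>x. (v t x)\<^sup>2 / (1 + (norm x)\<^sup>2)\<^sup>2) \<le> M * integral UNIV (\<lambda>x. \<Sum>i\<in>UNIV. (w i t x)\<^sup>2)"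
      unfolding M_def log_factor_def
      by (rule log_hardy_inequality[OF v_x cv[OF at(2)] cw[OF at(2)] v_supp])
    \<comment> \<open>Young's inequality for the source term. The weight \<open>km / M\<close> is
      the one for which the Hardy constant M cancels and the resulting \<open>km |w|\<^sup>2\<close>
      is absorbed by \<open>K |w|\<^sup>2\<close>; the other weight \<open>M / km\<close> is the
      source of the logarithm.\<close>
    let ?h = "\<lambda>x. 2 * q t x + (M / km * ((ut a x)\<^sup>2 * (1 + (norm x)\<^sup>2)\<^sup>2)
       + (km / M * ((v t x)\<^sup>2 / (1 + (norm x)\<^sup>2)\<^sup>2) - km * (\<Sum>i\<in>UNIV. (w i t x)\<^sup>2)))"
    have pw: "(u t x)\<^sup>2 \<le> ?h x" for x
    proof -
      define \<sigma> where "\<sigma> = 1 + (norm x)\<^sup>2"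
      have \<sigma>: "\<sigma> > 0" unfolding \<sigma>_def by (smt (verit) zero_le_power2)
      have "2 * (ut a x * v t x) \<le> M / km * ((ut a x)\<^sup>2 * \<sigma>\<^sup>2) + km / M * ((v t x)\<^sup>2 / \<sigma>\<^sup>2)"
      proof -
        have "0 \<le> (M * \<sigma>\<^sup>2 * ut a x - km * v t x)\<^sup>2 / (M * km * \<sigma>\<^sup>2)" using M km_pos \<sigma> by simp
        also have "\<dots> = M / km * ((ut a x)\<^sup>2 * \<sigma>\<^sup>2) + km / M * ((v t x)\<^sup>2 / \<sigma>\<^sup>2) - 2 * (ut a x * v t x)"
          using M km_pos \<sigma> by (simp add: field_simps power2_eq_square)
        finally show ?thesis by simp
      qed
      moreover have "km * ((w 1 t x)\<^sup>2 + (w 2 t x)\<^sup>2) \<le> K x * ((w 1 t x)\<^sup>2 + (w 2 t x)\<^sup>2)"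
        by (intro mult_right_mono K_ge) simp
      moreover have "2 * q t x = (u t x)\<^sup>2 + K x * ((w 1 t x)\<^sup>2 + (w 2 t x)\<^sup>2) - 2 * (ut a x * v t x)"
        unfolding q_def by (simp add: field_simps)
      ultimately show ?thesis unfolding \<sigma>_def[symmetric] sum_2 by linarith
    qed
    have "integral UNIV (\<lambda>x. (u t x)\<^sup>2) \<le> integral UNIV ?h"
      by (rule integral_le[OF densities_integrable(4)[OF at(3)] _ pw])
        (intro integrable_add integrable_diff integrable_on_mult_right int_w int_v int_q uta_int)
    also have "integral UNIV ?h = 2 * N t + (M / km * C1 + (km / M * integral UNIV (\<lambda>x. (v t x)\<^sup>2 / (1 + (norm x)\<^sup>2)\<^sup>2)
       - km * integral UNIV (\<lambda>x. \<Sum>i\<in>UNIV. (w i t x)\<^sup>2)))"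
      unfolding N_def C1_def
      by (subst integral_diff integral_add | (intro integrable_add integrable_diff integrable_on_mult_right int_w int_v int_q uta_int)[1])+
        (simp only: integral_mult_right)
    also have "\<dots> \<le> 2 * N 1 + M / km * C1"
    proof -
      have "km / M * integral UNIV (\<lambda>x. (v t x)\<^sup>2 / (1 + (norm x)\<^sup>2)\<^sup>2) \<le> km / M * (M * integral UNIV (\<lambda>x. \<Sum>i\<in>UNIV. (w i t x)\<^sup>2))"
        using hardy M km_pos by (intro mult_left_mono) auto
      also have "\<dots> = km * integral UNIV (\<lambda>x. \<Sum>i\<in>UNIV. (w i t x)\<^sup>2)" using M by simp
      finally show ?thesis using N1[OF t] by simp
    qed
    also have "\<dots> \<le> (2 * \<bar>N 1\<bar> + C1 / km) * M"
    proof -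
      have "N 1 \<le> \<bar>N 1\<bar> * M" using M by (smt (verit) mult_le_cancel_left1)
      then show ?thesis by (simp add: algebra_simps)
    qed
    finally show ?thesis unfolding M_def .
  qed
  show ?thesis
    by (rule exI[of _ "2 * \<bar>N 1\<bar> + C1 / km"]) (use bound C1 km_pos in auto)
qed


section \<open>The Morawetz functional and the decay of the local energy\<close>

text \<open>Cauchy-Schwarz in space followed by the arithmetic-geometric mean inequality. The speed
  enters through any lower bound k of K at the point: \<open>km\<close> is inserted inside the ball,
  \<open>k0\<close> outside.\<close>

lemma flux_le_energy_density:
  assumes k: "0 < k" "k \<le> K x" and r: "norm x \<le> r"
  shows "\<bar>ut t x * (x$1 * p 1 t x + x$2 * p 2 t x)\<bar> \<le> r / sqrt k * energy_density t x"
proof -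
  define n where "n = (p 1 t x)\<^sup>2 + (p 2 t x)\<^sup>2"
  define y where "y = x$1 * p 1 t x + x$2 * p 2 t x"
  have n0: "n \<ge> 0" unfolding n_def by simp
  have r0: "0 \<le> r" using r norm_ge_zero order_trans by blast
  have "(norm x)\<^sup>2 * n - y\<^sup>2 = (x$1 * p 2 t x - x$2 * p 1 t x)\<^sup>2"
    unfolding norm_power2_vec2 n_def y_def by (simp add: algebra_simps power2_eq_square)
  then have "y\<^sup>2 \<le> (norm x)\<^sup>2 * n" by (smt (verit) zero_le_power2)
  also have "\<dots> \<le> r\<^sup>2 * n" using r n0 by (intro mult_right_mono power_mono) auto
  also have "\<dots> = (r * sqrt n)\<^sup>2" using n0 by (simp add: power_mult_distrib)
  finally have "\<bar>y\<bar> \<le> r * sqrt n" using r0 n0 by (simp add: abs_le_square_iff[symmetric])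
  then have "\<bar>ut t x * y\<bar> \<le> \<bar>ut t x\<bar> * (r * sqrt n)" by (simp add: abs_mult mult_left_mono)
  also have "\<dots> = r / sqrt k * (\<bar>ut t x\<bar> * (sqrt k * sqrt n))" using k by simp
  also have "\<dots> \<le> r / sqrt k * energy_density t x"
  proof (rule mult_left_mono)
    have "0 \<le> (\<bar>ut t x\<bar> - sqrt k * sqrt n)\<^sup>2" by simp
    also have "\<dots> = (ut t x)\<^sup>2 + k * n - 2 * (\<bar>ut t x\<bar> * (sqrt k * sqrt n))"
      using k n0 by (simp add: power2_diff power_mult_distrib)
    finally have "2 * (\<bar>ut t x\<bar> * (sqrt k * sqrt n)) \<le> (ut t x)\<^sup>2 + k * n" by simp
    also have "\<dots> \<le> (ut t x)\<^sup>2 + K x * n" using k n0 by (simp add: mult_right_mono)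
    also have "\<dots> = 2 * energy_density t x" unfolding energy_density_def n_def by simp
    finally show "\<bar>ut t x\<bar> * (sqrt k * sqrt n) \<le> energy_density t x" by simp
  qed (use r0 k in simp)
  finally show ?thesis unfolding y_def .
qed

definition morawetz :: "real \<Rightarrow> real" where
  "morawetz t = (t + \<rho> / sqrt k0) * integral UNIV (energy_density t) + integral UNIV (virial_density t)"

text \<open>The energy is conserved, so the growing weight contributes +E, which cancels the -E of
  the virial identity.\<close>

lemma morawetz_derivative:
  assumes "0 < t"
  shows "(morawetz has_real_derivative integral UNIV (drift_density t)) (at t)"
  unfolding morawetz_def
  by (rule energy_conserved[OF assms] virial_identity[OF assms] derivative_eq_intros refl)+ simp

text \<open>Outside the ball, \<open>|x| \<le> \<rho> + t sqrt k0\<close> on the support, so the weight \<open>t + \<rho> / sqrt k0\<close> dominates the flux term.\<close>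
lemma local_energy_le_morawetz:
  assumes R: "r0 < R" and t: "0 < t" and l: "0 < l"
  shows "(t + \<rho> / sqrt k0 - R / sqrt km) * integral (cball 0 R) (energy_density t)
    \<le> morawetz t + (l / 2 * integral UNIV (energy_density t) + 1 / (4 * l) * integral UNIV (\<lambda>x. (u t x)\<^sup>2))"
proof -
  let ?\<tau> = "t + \<rho> / sqrt k0"
  let ?g = "\<lambda>x. (?\<tau> * energy_density t x + virial_density t x) + (l / 2 * energy_density t x + 1 / (4 * l) * (u t x)\<^sup>2)"
  have t0: "0 \<le> t" using t by simp
  \<comment> \<open>The lower-order part of the multiplier is absorbed by completing the square
    \<open>(l * ut + u)\<^sup>2\<close>; l stays free so that the two costs can be balanced
    afterwards.\<close>
  have u_part: "ut t x * (u t x / 2) + (l / 2 * energy_density t x + 1 / (4 * l) * (u t x)\<^sup>2) \<ge> 0" for x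
  proof -
    have "K x * ((p 1 t x)\<^sup>2 + (p 2 t x)\<^sup>2) \<ge> 0" using K_pos[of x] by simp
    then have "(ut t x)\<^sup>2 / 2 \<le> energy_density t x" unfolding energy_density_def by simp
    then have "l / 2 * ((ut t x)\<^sup>2 / 2) \<le> l / 2 * energy_density t x" using l by (intro mult_left_mono) auto
    moreover have "0 \<le> (l * ut t x + u t x)\<^sup>2 / (4 * l)" using l by simp
    moreover have "(l * ut t x + u t x)\<^sup>2 / (4 * l) = l / 2 * ((ut t x)\<^sup>2 / 2) + ut t x * (u t x / 2) + 1 / (4 * l) * (u t x)\<^sup>2"
      using l by (simp add: field_simps power2_eq_square)
    ultimately show ?thesis by linarith
  qed
  have vir: "virial_density t x = ut t x * (x$1 * p 1 t x + x$2 * p 2 t x) + ut t x * (u t x / 2)" for x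
    unfolding virial_density_def by (simp add: algebra_simps)
  have "integral (cball 0 R) (\<lambda>x. (?\<tau> - R / sqrt km) * energy_density t x) \<le> integral UNIV ?g"
  proof (rule integral_le_UNIV_of_cball[where r="support_radius t"])
    show "continuous_on UNIV (\<lambda>x. (?\<tau> - R / sqrt km) * energy_density t x)" "continuous_on UNIV ?g"
      by (intro continuous_intros densities_continuous t0)+
    show "?g x = 0" if "norm x > support_radius t" for x
      using vanish[OF t that] by (simp add: energy_density_def virial_density_def)
    show "(?\<tau> - R / sqrt km) * energy_density t x \<le> ?g x" if "norm x \<le> R" for x
    proof -
      have "- (R / sqrt km * energy_density t x) \<le> ut t x * (x$1 * p 1 t x + x$2 * p 2 t x)"
        using flux_le_energy_density[OF km_pos K_ge that, of t] by linarith
      then show ?thesis using u_part[of x] unfolding vir left_diff_distrib by linarith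
    qed
    show "0 \<le> ?g x" if x: "norm x > R" for x
    proof (cases "norm x > support_radius t")
      case True
      then show ?thesis using vanish[OF t True] by (simp add: energy_density_def virial_density_def)
    next
      case False
      then have "norm x \<le> support_radius t" by simp
      moreover have "k0 \<le> K x" using K_ext[of x] x R by simp
      moreover have "support_radius t / sqrt k0 = ?\<tau>" unfolding support_radius_def using k0_pos by (simp add: field_simps)
      ultimately have "- (?\<tau> * energy_density t x) \<le> ut t x * (x$1 * p 1 t x + x$2 * p 2 t x)"
        using flux_le_energy_density[OF k0_pos, of x "support_radius t" t] by simp
      then show ?thesis using u_part[of x] unfolding vir by linarith
    qed
  qed
  also have "integral UNIV ?g = morawetz t + (l / 2 * integral UNIV (energy_density t) + 1 / (4 * l) * integral UNIV (\<lambda>x. (u t x)\<^sup>2))"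
    unfolding morawetz_def
    by (subst integral_add | (intro integrable_add integrable_on_mult_right densities_integrable t)[1])+
      (simp only: integral_mult_right)
  finally show ?thesis by (simp only: integral_mult_right)
qed

text \<open>Write Y for the Morawetz functional plus its error term and \<open>ER\<close> for the
  local energy. Then \<open>Y' \<le> \<eta> * ER\<close> and \<open>(t - d) * ER \<le> Y\<close>, so
  Y grows at most like the power \<eta> of \<open>t - d\<close>, and dividing once more by
  \<open>t - d\<close> yields the exponent \<open>\<eta> - 1\<close>.\<close>

theorem local_energy_decay:
  assumes eta: "0 \<le> \<eta>" "\<eta> < 1"
    and drift: "\<And>x. norm x \<le> r0 \<Longrightarrow> x$1 * dK 1 x + x$2 * dK 2 x \<le> \<eta> * K x"
    and R: "r0 < R"
  shows "(\<lambda>t. integral (cball 0 R) (energy_density t)) \<in> O(\<lambda>t. t powr (\<eta> - 1) * sqrt (ln t))"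
proof -
  \<comment> \<open>\<open>t - d\<close> is the weight left on the local energy after subtracting
    the flux inside the ball.\<close>
  define d where "d = R / sqrt km - \<rho> / sqrt k0"
  define ER where "ER t = integral (cball 0 R) (energy_density t)" for t
  define E where "E = integral UNIV (energy_density 1)"
  \<comment> \<open>Without integrability, which is not known for every real t, the integral is 0 by
    convention.\<close>
  have ER0: "0 \<le> ER t" for t
    unfolding ER_def
    by (cases "energy_density t integrable_on cball 0 R")
      (auto simp: energy_density_nonneg not_integrable_integral intro!: integral_nonneg)
  have E: "integral UNIV (energy_density t) = E" if "1 \<le> t" for t
    unfolding E_def
  proof (rule DERIV_isconst2[of 1 "t+1"])
    show "continuous_on {1..t+1} (\<lambda>t. integral UNIV (energy_density t))"
      by (rule DERIV_continuous_on[where D="\<lambda>_. 0"], rule has_field_derivative_at_within, rule energy_conserved) auto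
  qed (use that energy_conserved in auto)
  have E0: "E \<ge> 0" unfolding E_def
    by (rule integral_nonneg) (auto simp: energy_density_nonneg intro: densities_integrable)
  obtain C where C: "C \<ge> 0" "\<And>t. 1 \<le> t \<Longrightarrow> integral UNIV (\<lambda>x. (u t x)\<^sup>2) \<le> C * log_factor t"
    using L2_norm_log_growth by blast
  define B where "B = E / 2 + C / 4"
  have B0: "B \<ge> 0" unfolding B_def using E0 C by simp
  have lower: "(t - d) * ER t \<le> morawetz t + B * sqrt (log_factor t)" if "1 \<le> t" for t
  proof -
    let ?M = "log_factor t"
    have M: "?M > 0" using log_factor_ge_1[of t] by linarith
    \<comment> \<open>With \<open>l = sqrt (log_factor t)\<close> the cost \<open>l * E\<close> and
      the cost \<open>log_factor t / l\<close> of the L2 norm have the same size; this is where the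
      square root of the logarithm originates.\<close>
    have "(t - d) * ER t \<le> morawetz t + (sqrt ?M / 2 * E + 1 / (4 * sqrt ?M) * integral UNIV (\<lambda>x. (u t x)\<^sup>2))"
      using local_energy_le_morawetz[OF R, of t "sqrt ?M"] that M E[OF that]
      unfolding ER_def d_def by (simp add: algebra_simps)
    also have "\<dots> \<le> morawetz t + (sqrt ?M / 2 * E + 1 / (4 * sqrt ?M) * (C * ?M))"
      using C(2)[OF that] M by (intro add_left_mono mult_left_mono) auto
    also have "1 / (4 * sqrt ?M) * (C * ?M) = C / 4 * sqrt ?M"
      using M by (simp add: field_simps)
    finally show ?thesis unfolding B_def by (simp add: algebra_simps)
  qed
  have drift_le: "integral UNIV (drift_density t) \<le> \<eta> * ER t" if t: "1 \<le> t" for t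
  proof -
    \<comment> \<open>Both sides are negated, since the comparison lemma puts the local integral on
      the smaller side.\<close>
    have "integral (cball 0 R) (\<lambda>x. (- \<eta>) * energy_density t x) \<le> integral UNIV (\<lambda>x. - drift_density t x)"
    proof (rule integral_le_UNIV_of_cball[where r=r0])
      show "continuous_on UNIV (\<lambda>x. - \<eta> * energy_density t x)" "continuous_on UNIV (\<lambda>x. - drift_density t x)"
        using t by (intro continuous_intros densities_continuous; simp)+
      show "- drift_density t x = 0" if "norm x > r0" for x
        using dK_ext[OF that] unfolding drift_density_def by simp
      then show "0 \<le> - drift_density t x" if "norm x > R" for x using that R by simp
      show "- \<eta> * energy_density t x \<le> - drift_density t x" for x
      proof -
        have le: "x$1 * dK 1 x + x$2 * dK 2 x \<le> \<eta> * K x"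
        proof (cases "norm x \<le> r0")
          case False
          then show ?thesis using dK_ext[of x] eta K_pos[of x] by simp
        qed (rule drift)
        have "(x$1 * dK 1 x + x$2 * dK 2 x) * ((p 1 t x)\<^sup>2 + (p 2 t x)\<^sup>2) \<le> \<eta> * K x * ((p 1 t x)\<^sup>2 + (p 2 t x)\<^sup>2)"
          by (rule mult_right_mono[OF le]) simp
        moreover have "0 \<le> \<eta> * (ut t x)\<^sup>2" using eta by simp
        ultimately show ?thesis unfolding energy_density_def drift_density_def by (simp add: algebra_simps)
      qed
    qed
    then show ?thesis unfolding ER_def by simp
  qed
  \<comment> \<open>From here on the bounds for t \<ge> 1 hold and the base \<open>t - d\<close> is
    at least 1, so its power \<open>- \<eta>\<close> is at most 1.\<close>
  define t1 where "t1 = max 1 (d + 1)"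
  define G1 where "G1 = \<bar>morawetz t1\<bar>"
  have gronwall: "ER T \<le> (G1 + B * sqrt (log_factor T)) * (T - d) powr (\<eta> - 1)" if T: "t1 \<le> T" for T
  proof -
    \<comment> \<open>The error is frozen at the final time T: by monotonicity it dominates all
      earlier ones, and as a constant in s it does not contribute to the derivative.\<close>
    define A where "A = B * sqrt (log_factor T)"
    have A0: "A \<ge> 0" unfolding A_def using B0 log_factor_ge_1[of T] by simp
    have Td: "T - d \<ge> 1" using T unfolding t1_def by simp
    have "(morawetz T + A) * (T - d) powr (- \<eta>) \<le> (morawetz t1 + A) * (t1 - d) powr (- \<eta>)"
    proof (rule DERIV_nonpos_imp_nonincreasing[OF T])
      fix s assume s: "t1 \<le> s" "s \<le> T"
      have s1: "1 \<le> s" "s - d \<ge> 1" using s unfolding t1_def by auto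
      have "log_factor s \<le> log_factor T" using s s1 by (intro log_factor_mono) auto
      then have "B * sqrt (log_factor s) \<le> A" unfolding A_def using B0 by (simp add: mult_left_mono)
      then have "(s - d) * ER s \<le> morawetz s + A" using lower[OF s1(1)] by linarith
      then have "\<eta> * ((s - d) * ER s) \<le> \<eta> * (morawetz s + A)" using eta by (intro mult_left_mono)
      moreover have "(s - d) * integral UNIV (drift_density s) \<le> (s - d) * (\<eta> * ER s)"
        using drift_le[OF s1(1)] s1 by (intro mult_left_mono) auto
      ultimately have le: "(s - d) * integral UNIV (drift_density s) - \<eta> * (morawetz s + A) \<le> 0"
        by (simp add: algebra_simps)
      have "((\<lambda>s. (morawetz s + A) * (s - d) powr (- \<eta>)) has_real_derivative
          ((s - d) * integral UNIV (drift_density s) - \<eta> * (morawetz s + A)) * (s - d) powr (- \<eta> - 1)) (at s)"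
      proof -
        have sp: "(s - d) powr (- \<eta>) = (s - d) * (s - d) powr (- \<eta> - 1)"
          using s1 by (simp add: powr_mult_base)
        have D: "((\<lambda>s. (s - d) powr (- \<eta>)) has_real_derivative - \<eta> * (s - d) powr (- \<eta> - 1)) (at s)"
          using s1 by (auto intro!: derivative_eq_intros)
        have "((\<lambda>s. (morawetz s + A) * (s - d) powr (- \<eta>)) has_real_derivative
          integral UNIV (drift_density s) * (s - d) powr (- \<eta>) + (- \<eta> * (s - d) powr (- \<eta> - 1)) * (morawetz s + A)) (at s)"
          by (rule DERIV_mult[OF _ D]) (use s1 in \<open>auto intro!: derivative_eq_intros morawetz_derivative\<close>)
        then show ?thesis unfolding sp by (simp add: algebra_simps)
      qed
      moreover have "((s - d) * integral UNIV (drift_density s) - \<eta> * (morawetz s + A)) * (s - d) powr (- \<eta> - 1) \<le> 0"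
        using le by (intro mult_nonpos_nonneg) auto
      ultimately show "\<exists>y. ((\<lambda>s. (morawetz s + A) * (s - d) powr (- \<eta>)) has_real_derivative y) (at s) \<and> y \<le> 0"
        by blast
    qed
    also have "\<dots> \<le> (G1 + A) * 1"
    proof (rule mult_mono)
      show "(t1 - d) powr - \<eta> \<le> 1" using eta powr_mono[of "- \<eta>" 0 "t1 - d"] unfolding t1_def by simp
    qed (use A0 G1_def in auto)
    finally have "(morawetz T + A) * (T - d) powr (- \<eta>) \<le> G1 + A" by simp
    then have "(morawetz T + A) * (T - d) powr (- \<eta>) * (T - d) powr (\<eta> - 1) \<le> (G1 + A) * (T - d) powr (\<eta> - 1)"
      by (intro mult_right_mono) auto
    moreover have "(T - d) powr (- \<eta>) * (T - d) powr (\<eta> - 1) = 1 / (T - d)"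
      using Td by (simp add: powr_minus_divide powr_diff)
    ultimately have "(morawetz T + A) / (T - d) \<le> (G1 + A) * (T - d) powr (\<eta> - 1)"
      by (simp add: mult.assoc)
    moreover have "ER T \<le> (morawetz T + A) / (T - d)"
      using lower[of T] T Td unfolding A_def t1_def by (simp add: field_simps)
    ultimately show ?thesis unfolding A_def by linarith
  qed
  define c where "c = sqrt k0"
  have c: "c > 0" unfolding c_def using k0_pos by simp
  \<comment> \<open>The support radius is linear in t, so the left side is \<open>2 * ln t\<close>
    up to a bounded term.\<close>
  have ev1: "\<forall>\<^sub>F t in at_top. log_factor t \<le> 4 * ln t"
    unfolding log_factor_def support_radius_def c_def[symmetric] using c by real_asymp
  show ?thesis
  proof (rule bigoI[where c="(G1 + B) * 2 * 2 powr (1 - \<eta>)"])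
    have "\<forall>\<^sub>F t in at_top. t \<ge> max (max 2 t1) (2 * \<bar>d\<bar>)" by (rule eventually_ge_at_top)
    with ev1 show "\<forall>\<^sub>F t in at_top. norm (integral (cball 0 R) (energy_density t)) \<le> (G1 + B) * 2 * 2 powr (1 - \<eta>) * norm (t powr (\<eta> - 1) * sqrt (ln t))"
    proof eventually_elim
      case (elim t)
      then have t: "t \<ge> 2" "t \<ge> t1" "t - d \<ge> t / 2" by auto
      have M: "1 \<le> sqrt (log_factor t)" using log_factor_ge_1 by simp
      have "sqrt (log_factor t) \<le> sqrt (4 * ln t)" using elim by simp
      then have M2: "sqrt (log_factor t) \<le> 2 * sqrt (ln t)" by (simp add: real_sqrt_mult)
      have "ER t \<le> (G1 + B * sqrt (log_factor t)) * (t - d) powr (\<eta> - 1)" by (rule gronwall[OF t(2)])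
      also have "\<dots> \<le> ((G1 + B) * (2 * sqrt (ln t))) * (2 powr (1 - \<eta>) * t powr (\<eta> - 1))"
      proof (rule mult_mono)
        have "G1 \<le> G1 * sqrt (log_factor t)" using M unfolding G1_def by (simp add: mult_le_cancel_left1)
        then have "G1 + B * sqrt (log_factor t) \<le> (G1 + B) * sqrt (log_factor t)" by (simp add: algebra_simps)
        also have "\<dots> \<le> (G1 + B) * (2 * sqrt (ln t))" using M2 B0 G1_def by (intro mult_left_mono) auto
        finally show "G1 + B * sqrt (log_factor t) \<le> (G1 + B) * (2 * sqrt (ln t))" .
        \<comment> \<open>The exponent is negative, so the lower bound
          \<open>t - d \<ge> t / 2\<close> becomes an upper bound.\<close>
        have "(t - d) powr (\<eta> - 1) \<le> (t / 2) powr (\<eta> - 1)" using t eta by (intro powr_mono2') auto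
        also have "\<dots> = 2 powr (1 - \<eta>) * t powr (\<eta> - 1)"
          using t by (simp add: powr_divide powr_diff field_simps)
        finally show "(t - d) powr (\<eta> - 1) \<le> 2 powr (1 - \<eta>) * t powr (\<eta> - 1)" .
      qed (use t B0 G1_def in auto)
      finally show ?case using ER0[of t] t unfolding ER_def by (simp add: algebra_simps)
    qed
  qed
qed

end

section \<open>Reduction to coordinates\<close>

text \<open>Lines in spatial directions stay inside the closed half space t \<ge> 0, so spatial
  derivatives are two-sided even at t = 0; time derivatives require t > 0.\<close>

lemma has_derivative_within_imp_line:
  fixes f :: "'a::real_normed_vector \<Rightarrow> real"
  assumes "(f has_derivative D) (at z within S)" and "\<And>h. z + h *\<^sub>R v \<in> S"
  shows "((\<lambda>h. f (z + h *\<^sub>R v)) has_real_derivative D v) (at 0)"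
proof -
  have "((\<lambda>h::real. z + h *\<^sub>R v) has_derivative (\<lambda>h. h *\<^sub>R v)) (at 0)"
    by (auto intro!: derivative_eq_intros)
  then have "((\<lambda>h. f (z + h *\<^sub>R v)) has_derivative (\<lambda>h. D (h *\<^sub>R v))) (at 0)"
  proof (rule has_derivative_in_compose)
    show "(f has_derivative D) (at (z + 0 *\<^sub>R v) within range (\<lambda>h. z + h *\<^sub>R v))"
      by (rule has_derivative_subset[where s=S]) (use assms in auto)
  qed
  moreover have "linear D" using assms(1) has_derivative_linear by blast
  ultimately show ?thesis
    by (simp add: has_field_derivative_def linear_scale mult.commute[of _ "D v"])
qed

text \<open>Fundamental theorem of calculus in \<open>s\<close>, differentiated under the integral in direction \<open>v\<close>.\<close>
lemma mixed_derivative: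
  fixes f A B C :: "real \<Rightarrow> 'a::real_normed_vector \<Rightarrow> real"
  assumes A: "\<And>s x. a \<le> s \<Longrightarrow> ((\<lambda>s. f s x) has_real_derivative A s x) (at s)"
    and B: "\<And>s x. a \<le> s \<Longrightarrow> ((\<lambda>h. f s (x + h *\<^sub>R v)) has_real_derivative B s x) (at 0)"
    and C: "\<And>s x. a \<le> s \<Longrightarrow> ((\<lambda>h. A s (x + h *\<^sub>R v)) has_real_derivative C s x) (at 0)"
    and cA: "continuous_on ({a..} \<times> UNIV) (\<lambda>z. A (fst z) (snd z))"
    and cC: "continuous_on ({a..} \<times> UNIV) (\<lambda>z. C (fst z) (snd z))"
    and t: "a < t"
  shows "((\<lambda>s. B s x) has_real_derivative C t x) (at t)"
proof -
  have f: "f s x = f a x + integral {a..s} (\<lambda>\<sigma>. A \<sigma> x)" if s: "a \<le> s" for s x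
  proof -
    have "((\<lambda>\<sigma>. A \<sigma> x) has_integral (f s x - f a x)) {a..s}"
    proof (rule fundamental_theorem_of_calculus[OF s])
      show "((\<lambda>\<sigma>. f \<sigma> x) has_vector_derivative A \<sigma> x) (at \<sigma> within {a..s})" if "\<sigma> \<in> {a..s}" for \<sigma>
        unfolding has_real_derivative_iff_has_vector_derivative[symmetric]
        by (rule has_field_derivative_at_within, rule A) (use that in auto)
    qed
    then show ?thesis by (simp add: integral_unique)
  qed
  have Bs: "B s x = B a x + integral {a..s} (\<lambda>\<sigma>. C \<sigma> x)" if s: "a \<le> s" for s
  proof (rule DERIV_unique[OF B[OF s]])
    show "((\<lambda>h. f s (x + h *\<^sub>R v)) has_real_derivative B a x + integral {a..s} (\<lambda>\<sigma>. C \<sigma> x)) (at 0)"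
      unfolding f[OF s]
      by (rule DERIV_add[OF B[OF order_refl]
            antiderivative_directional_derivative[where g=A and g'=C, OF C cA cC]])
  qed
  have ev: "\<forall>\<^sub>F s in nhds t. B s x = B a x + integral {a..s} (\<lambda>\<sigma>. C \<sigma> x)"
    using eventually_nhds_in_open[of "{a<..}" t] t by (auto elim!: eventually_mono intro: Bs)
  have "((\<lambda>s. B a x + integral {a..s} (\<lambda>\<sigma>. C \<sigma> x)) has_real_derivative 0 + C t x) (at t)"
    by (rule DERIV_add[OF DERIV_const antiderivative_time_derivative[OF continuous_on_slice_fst[OF cC UNIV_I] t]])
  then show ?thesis unfolding DERIV_cong_ev[OF refl ev refl] by simp
qed

lemma zero_outside_support:
  assumes "support f \<subseteq> cball 0 L" "norm x > L"
  shows "f x = 0"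
  using assms closure_subset[of "{x. f x \<noteq> 0}"] unfolding support_def by (force simp: mem_cball)

theorem theorem5p1:
  fixes K :: "real^2 \<Rightarrow> real"
    and km r0 k0 L R :: real
    and u0 u1 :: "real^2 \<Rightarrow> real"
    and u :: "real \<Rightarrow> real^2 \<Rightarrow> real"
    and Du :: "real \<times> (real^2) \<Rightarrow> (real \<times> (real^2)) \<Rightarrow>\<^sub>L real"
    and D2u :: "real \<times> (real^2) \<Rightarrow> (real \<times> (real^2)) \<Rightarrow>\<^sub>L ((real \<times> (real^2)) \<Rightarrow>\<^sub>L real)"
  assumes K_BC1: "BC1 K"
    and km_pos: "km > 0" and K_lower: "\<forall>x. K x \<ge> km"
    and r0_pos: "r0 > 0" and k0_ge: "k0 \<ge> km"
    and K_const: "\<forall>x. norm x > r0 \<longrightarrow> K x = k0"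
    and grad_bdd: "bounded (range (grad K))"
    and eta0: "0 \<le> r0 / km * grad_sup_norm K" "r0 / km * grad_sup_norm K < 1"
    and L_pos: "L > 0"
    and u0_smooth: "smooth u0" and u1_smooth: "smooth u1"
    and u0_supp: "support u0 \<subseteq> cball 0 L" and u1_supp: "support u1 \<subseteq> cball 0 L"
    and u_D1: "\<forall>z \<in> {0..} \<times> UNIV. ((\<lambda>(t, x). u t x) has_derivative blinfun_apply (Du z)) (at z within {0..} \<times> UNIV)"
    and u_D2: "\<forall>z \<in> {0..} \<times> UNIV. (Du has_derivative blinfun_apply (D2u z)) (at z within {0..} \<times> UNIV)"
    and u_C2: "continuous_on ({0..} \<times> UNIV) D2u"
    and u_eq: "\<forall>t > 0. \<forall>x. \<exists>D.
        ((\<lambda>y. \<chi> i. K y * Du (t, y) (0, axis i 1)) has_derivative D) (at x) \<and>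
        D2u (t, x) (1, 0) (1, 0) = (\<Sum>i\<in>UNIV. D (axis i 1) $ i)"
    and u_init0: "\<forall>x. u 0 x = u0 x"
    and u_init1: "\<forall>x. Du (0, x) (1, 0) = u1 x"
    and R_gt: "R > r0"
  shows "(\<lambda>t. (1/2) * integral (cball 0 R)
            (\<lambda>x. (Du (t, x) (1, 0))\<^sup>2 + K x * (norm (\<chi> i. Du (t, x) (0, axis i 1)))\<^sup>2))
         \<in> O(\<lambda>t. t powr (r0 / km * grad_sup_norm K - 1) * sqrt (ln t))"
proof -
  let ?S = "{0..} \<times> (UNIV :: (real^2) set)"
  \<comment> \<open>Outside this radius the data vanish and K is constant, as the cone argument
    requires.\<close>
  define \<rho> where "\<rho> = max L r0"
  define ut where "ut t x = Du (t, x) (1, 0)" for t x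
  define p where "p i t x = Du (t, x) (0, axis i 1)" for i t x
  define utt where "utt t x = D2u (t, x) (1, 0) (1, 0)" for t x
  define pt where "pt i t x = D2u (t, x) (0, axis i 1) (1, 0)" for i t x
  define pp where "pp i j t x = D2u (t, x) (0, axis j 1) (0, axis i 1)" for i j t x
  have D1: "((\<lambda>(t, x). u t x) has_derivative blinfun_apply (Du z)) (at z within ?S)" if "z \<in> ?S" for z
    using u_D1 that by blast
  have D2: "((\<lambda>z. Du z w) has_derivative (\<lambda>v. D2u z v w)) (at z within ?S)" if "z \<in> ?S" for z w
    by (rule bounded_linear.has_derivative[OF blinfun.bounded_linear_left]) (use u_D2 that in blast)
  have line_x: "((\<lambda>h. f (t, x + h *\<^sub>R axis i 1)) has_real_derivative D (0, axis i 1)) (at 0)"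
    if "(f has_derivative D) (at (t, x) within ?S)" "0 \<le> t" for f D t x i
    using has_derivative_within_imp_line[OF that(1), of "(0, axis i 1)"] that(2) by simp
  have line_t: "((\<lambda>t. f (t, x)) has_real_derivative D (1, 0)) (at t)"
    if "(f has_derivative D) (at (t, x) within ?S)" "0 < t" for f D t x
  proof -
    have "(t, x) \<in> interior ?S" using that(2) by (simp add: interior_Times)
    then have "(f has_derivative D) (at (t, x))" using that(1) at_within_interior by metis
    from has_derivative_within_imp_line[OF this, of "(1, 0)"]
    have "((\<lambda>h. f (t + h, x)) has_real_derivative D (1, 0)) (at 0)" by simp
    then show ?thesis using DERIV_shift[of "\<lambda>t. f (t, x)" "D (1, 0)" 0 t] by (simp add: add.commute)
  qed
  have u_t: "((\<lambda>t. u t x) has_real_derivative ut t x) (at t)" if "0 < t" for t x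
    using line_t[OF D1[of "(t, x)"]] that unfolding ut_def by simp
  have u_x: "((\<lambda>h. u t (x + h *\<^sub>R axis i 1)) has_real_derivative p i t x) (at 0)" if "0 \<le> t" for t x i
    using line_x[OF D1[of "(t, x)"], of i] that unfolding p_def by simp
  have ut_t: "((\<lambda>t. ut t x) has_real_derivative utt t x) (at t)" if "0 < t" for t x
    using line_t[OF D2[of "(t, x)" "(1, 0)"]] that unfolding ut_def utt_def by simp
  have ut_x: "((\<lambda>h. ut t (x + h *\<^sub>R axis i 1)) has_real_derivative pt i t x) (at 0)" if "0 \<le> t" for t x i
    using line_x[OF D2[of "(t, x)" "(1, 0)"], of i] that unfolding ut_def pt_def by simp
  have p_x: "((\<lambda>h. p i t (x + h *\<^sub>R axis j 1)) has_real_derivative pp i j t x) (at 0)" if "0 \<le> t" for t x i j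
    using line_x[OF D2[of "(t, x)" "(0, axis i 1)"], of j] that unfolding p_def pp_def by simp
  have cDu: "continuous_on ?S Du"
    by (rule has_derivative_continuous_on[where f'="\<lambda>z. blinfun_apply (D2u z)"]) (use u_D2 in blast)
  have cu: "continuous_on ?S (\<lambda>z. u (fst z) (snd z))"
    using has_derivative_continuous_on[OF D1] by (simp add: split_beta)
  have cut: "continuous_on ?S (\<lambda>z. ut (fst z) (snd z))" and cp: "continuous_on ?S (\<lambda>z. p i (fst z) (snd z))"
    and cutt: "continuous_on ?S (\<lambda>z. utt (fst z) (snd z))" and cpt: "continuous_on ?S (\<lambda>z. pt i (fst z) (snd z))"
    and cpp: "continuous_on ?S (\<lambda>z. pp i j (fst z) (snd z))" for i j
    unfolding ut_def p_def utt_def pt_def pp_def prod.collapse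
    by (intro continuous_intros cDu u_C2)+
  have p_t: "((\<lambda>t. p i t x) has_real_derivative pt i t x) (at t)" if t: "0 < t" for t x i
  \<comment> \<open>The base time must be positive, because the time derivative of u is two-sided
    only there, and strictly below t.\<close>
  proof (rule mixed_derivative[where a="t/2" and f=u and A=ut and B="p i" and C="pt i" and v="axis i 1"])
    have sub: "{t/2..} \<times> UNIV \<subseteq> ?S" using t by auto
    show "continuous_on ({t/2..} \<times> UNIV) (\<lambda>z. ut (fst z) (snd z))"
      "continuous_on ({t/2..} \<times> UNIV) (\<lambda>z. pt i (fst z) (snd z))"
      using continuous_on_subset[OF cut sub] continuous_on_subset[OF cpt sub] by auto
  qed (use t in \<open>simp_all add: u_t u_x ut_x\<close>)
  have pp_sym: "pp i j t x = pp j i t x" if t: "0 < t" for t x i j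
  proof -
    \<comment> \<open>Symmetry follows from the same lemma, with the coordinate along
      \<open>axis j 1\<close> in the role of time. Starting from y puts x at parameter 1, strictly
      above the base value 0.\<close>
    define y where "y = x - axis j 1"
    have c: "continuous_on ({0..} \<times> UNIV) (\<lambda>z. q t (snd z + fst z *\<^sub>R axis j 1))"
      if "continuous_on ?S (\<lambda>z. q (fst z) (snd z))" for q :: "real \<Rightarrow> real^2 \<Rightarrow> real"
    proof (rule continuous_on_compose2[where f="\<lambda>z. snd z + fst z *\<^sub>R axis j 1" and t=UNIV])
      show "continuous_on UNIV (q t)" by (rule continuous_on_slice[OF that]) (use t in simp)
    qed (auto intro!: continuous_intros)
    have 1: "((\<lambda>s. p i t (y + s *\<^sub>R axis j 1)) has_real_derivative pp j i t (y + 1 *\<^sub>R axis j 1)) (at 1)"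
    proof (rule mixed_derivative[where a=0 and f="\<lambda>s y. u t (y + s *\<^sub>R axis j 1)"
          and A="\<lambda>s y. p j t (y + s *\<^sub>R axis j 1)" and B="\<lambda>s y. p i t (y + s *\<^sub>R axis j 1)"
          and C="\<lambda>s y. pp j i t (y + s *\<^sub>R axis j 1)" and v="axis i 1"])
      show "((\<lambda>s. u t (x + s *\<^sub>R axis j 1)) has_real_derivative p j t (x + s *\<^sub>R axis j 1)) (at s)" for s x
        by (rule directional_derivative_shift) (use u_x t in simp)
      show "((\<lambda>h. u t (x + h *\<^sub>R axis i 1 + s *\<^sub>R axis j 1)) has_real_derivative p i t (x + s *\<^sub>R axis j 1)) (at 0)" for s x
        using u_x[of t "x + s *\<^sub>R axis j 1" i] t by (simp add: algebra_simps)
      show "((\<lambda>h. p j t (x + h *\<^sub>R axis i 1 + s *\<^sub>R axis j 1)) has_real_derivative pp j i t (x + s *\<^sub>R axis j 1)) (at 0)" for s x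
        using p_x[of t j "x + s *\<^sub>R axis j 1" i] t by (simp add: algebra_simps)
    qed (use c[OF cp] c[OF cpp] in auto)
    have "((\<lambda>s. p i t (y + s *\<^sub>R axis j 1)) has_real_derivative pp i j t (y + 1 *\<^sub>R axis j 1)) (at 1)"
      by (rule directional_derivative_shift) (use p_x t in simp)
    with 1 have "pp j i t (y + 1 *\<^sub>R axis j 1) = pp i j t (y + 1 *\<^sub>R axis j 1)" by (rule DERIV_unique)
    then show ?thesis unfolding y_def by simp
  qed
  have K_x: "((\<lambda>h. K (x + h *\<^sub>R axis i 1)) has_real_derivative pd i K x) (at 0)" for x i
  proof -
    have "(K has_derivative frechet_derivative K (at x)) (at x)"
      using K_BC1 frechet_derivative_works unfolding BC1_def by blast
    from has_derivative_within_imp_line[OF this, of "axis i 1"] show ?thesis unfolding pd_def by simp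
  qed
  have wave_eq: "utt t x = (\<Sum>i\<in>UNIV. pd i K x * p i t x + K x * pp i i t x)" if t: "0 < t" for t x
  proof -
    obtain D where D: "((\<lambda>y. \<chi> i. K y * Du (t, y) (0, axis i 1)) has_derivative D) (at x)"
      "D2u (t, x) (1, 0) (1, 0) = (\<Sum>i\<in>UNIV. D (axis i 1) $ i)"
      using u_eq t by blast
    \<comment> \<open>The diagonal entries of D and the product rule both give the derivative of the
      i-th flux component along the i-th axis, so uniqueness expands the divergence.\<close>
    have "D (axis i 1) $ i = pd i K x * p i t x + K x * pp i i t x" for i
    proof (rule DERIV_unique)
      have "((\<lambda>y. (\<chi> i. K y * Du (t, y) (0, axis i 1)) $ i) has_derivative (\<lambda>v. D v $ i)) (at x)"
        by (rule bounded_linear.has_derivative[OF bounded_linear_vec_nth D(1)])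
      from has_derivative_within_imp_line[OF this, of "axis i 1"]
      show "((\<lambda>h. K (x + h *\<^sub>R axis i 1) * p i t (x + h *\<^sub>R axis i 1)) has_real_derivative D (axis i 1) $ i) (at 0)"
        unfolding p_def by simp
      show "((\<lambda>h. K (x + h *\<^sub>R axis i 1) * p i t (x + h *\<^sub>R axis i 1)) has_real_derivative
          pd i K x * p i t x + K x * pp i i t x) (at 0)"
        by (rule K_x p_x[OF less_imp_le[OF t]] derivative_eq_intros refl)+ (simp add: algebra_simps)
    qed
    then show ?thesis unfolding utt_def D(2) by simp
  qed
  have u_init: "u 0 x = 0" if "norm x > \<rho>" for x
    using zero_outside_support[OF u0_supp, of x] u_init0 that unfolding \<rho>_def by simp
  interpret wave_solution K "\<lambda>i. pd i K" u ut utt p pt pp km r0 k0 \<rho>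
  proof
    show "continuous_on UNIV K" "continuous_on UNIV (pd i K)" for i
      using K_BC1 unfolding BC1_def by auto
    show "ut 0 x = 0" if "norm x > \<rho>" for x
      using zero_outside_support[OF u1_supp, of x] u_init1 that unfolding \<rho>_def ut_def by simp
    show "p i 0 x = 0" if "norm x > \<rho>" for x i
      by (rule derivative_zero_if_locally_zero[OF u_x, where S="- cball 0 \<rho>"]) (use that u_init in auto)
    show "u 0 x = 0" if "norm x > \<rho>" for x by (rule u_init[OF that])
    show "pp i j t x = pp j i t x" if "0 < t" for t x i j by (rule pp_sym[OF that])
    show "utt t x = (\<Sum>i\<in>UNIV. pd i K x * p i t x + K x * pp i i t x)" if "0 < t" for t x
      by (rule wave_eq[OF that])
  qed (use km_pos K_lower r0_pos K_const in \<open>simp_all add: K_x cu cut cutt cp cpt cpp u_t u_x ut_t ut_x p_t p_x \<rho>_def\<close>)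
  have "(\<lambda>t. integral (cball 0 R) (energy_density t)) \<in> O(\<lambda>t. t powr (r0 / km * grad_sup_norm K - 1) * sqrt (ln t))"
  proof (rule local_energy_decay[OF eta0 _ R_gt])
    fix x :: "real^2" assume x: "norm x \<le> r0"
    have "bdd_above (range (\<lambda>x. norm (grad K x)))"
      using grad_bdd unfolding bounded_iff bdd_above_def by auto
    then have "norm (grad K x) \<le> grad_sup_norm K" unfolding grad_sup_norm_def by (rule cSUP_upper[OF UNIV_I])
    have "x$1 * pd 1 K x + x$2 * pd 2 K x = x \<bullet> grad K x"
      by (simp add: inner_vec_def sum_2 grad_def)
    also have "\<dots> \<le> norm x * norm (grad K x)" by (rule norm_cauchy_schwarz)
    also have "\<dots> \<le> r0 * grad_sup_norm K" using x \<open>norm (grad K x) \<le> _\<close> r0_pos by (intro mult_mono) auto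
    also have "\<dots> = r0 / km * grad_sup_norm K * km" using km_pos by simp
    also have "\<dots> \<le> r0 / km * grad_sup_norm K * K x" using eta0 K_lower by (intro mult_left_mono) auto
    finally show "x$1 * pd 1 K x + x$2 * pd 2 K x \<le> r0 / km * grad_sup_norm K * K x" .
  qed
  moreover have "energy_density t = (\<lambda>x. (1/2) * ((Du (t, x) (1, 0))\<^sup>2 + K x * (norm (\<chi> i. Du (t, x) (0, axis i 1)))\<^sup>2))" for t
    by (rule ext, subst energy_density_def) (simp add: ut_def p_def norm_power2_vec2)
  ultimately show ?thesis by (simp only: integral_mult_right)
qed

end
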